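(* Let $d\ge1$ and suppose $\kappa_d$ is algebraic, with $D=[\mathbb{Q}(\kappa_d):\mathbb{Q}]$ and $h_0=h(\kappa_d)$. Then: (1) For every $n\ge1$ with $a_d(n)\ne\kappa_d^{n^d}$, $$-\frac1{n^d}\log\bigl|a_d(n)-\kappa_d^{n^d}\bigr|\le D(\log2+h_0)+\frac{D\log2}{n^d}.$$ (2) Set $C_1=h_0+2\log2$. For every $n\ge1$ with $a_d(n)\ne\kappa_d^{n^d}$, $$\deg(\gamma_n)\ \ge\ \frac{-\log|\gamma_n-\kappa_d|}{D\,C_1}\ \ge\ \frac{\log n-\log(2\sqrt3\,d\log2)}{D\,C_1}.$$
   Context: For integers $d,n\ge1$, $T_d(n)$ is the Cayley graph of $(\mathbb{Z}/n\mathbb{Z})^d$ with respect to $\{\pm e_1,\dots,\pm e_d\}\setminus\{0\}$ ($e_i$ the standard basis vectors); it is a simple graph, and $T_d(1)$ is a single vertex with no edges. $a_d(n)$ is the number of independent sets of $T_d(n)$ (including the empty set), so $a_d(1)=2$. The limit $\kappa_d=\lim_{n\to\infty}a_d(n)^{1/n^d}$ exists and is a positive real number. $\gamma_n=a_d(n)^{1/n^d}$ is the positive real $n^d$-th root, and $\deg(\gamma)=[\mathbb{Q}(\gamma):\mathbb{Q}]$. $\log$ is the natural logarithm. For a nonzero algebraic number $\gamma$ of degree $g$ with conjugates $\gamma_1,\dots,\gamma_g\in\mathbb{C}$ and primitive integral minimal polynomial $a_0X^g+\cdots+a_g\in\mathbb{Z}[X]$ ($a_0>0$, $\gcd(a_0,\dots,a_g)=1$),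 the Mahler measure is $M(\gamma)=a_0\prod_{i=1}^g\max(1,|\gamma_i|)$ and the logarithmic Weil height is $h(\gamma)=\frac1g\log M(\gamma)$. *)

theory Defs
  imports
    "HOL-Algebra.Algebra"
    "Berlekamp_Zassenhaus.Mahler_Measure"
begin

text \<open>Cayley graphs as sets of undirected edges. For \<open>S\<close> symmetric and not containing \<open>\<one>\<close>, every
  edge has exactly two elements, so this is a simple graph on \<open>carrier G\<close>.\<close>

definition cayley_edges :: "('a, 'b) monoid_scheme \<Rightarrow> 'a set \<Rightarrow> 'a set set" where
  "cayley_edges G S = {{x, x \<otimes>\<^bsub>G\<^esub> s} | x s. x \<in> carrier G \<and> s \<in> S}"

definition independent_sets :: "'a set \<Rightarrow> 'a set set \<Rightarrow> 'a set set" where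
  "independent_sets V E = {I. I \<subseteq> V \<and> (\<forall>e\<in>E. \<not> e \<subseteq> I)}"

definition torus_group :: "nat \<Rightarrow> nat \<Rightarrow> (nat \<Rightarrow> int) monoid" where
  "torus_group d n = product_group {..<d} (\<lambda>_. integer_mod_group n)"

text \<open>Residues are represented in \<open>{0..<n}\<close>, so the nonzero coordinate of \<open>e\<^sub>i\<close> is \<open>1 mod n\<close>,
  which is \<open>0\<close> for \<open>n = 1\<close>.\<close>

definition torus_basis :: "nat \<Rightarrow> nat \<Rightarrow> nat \<Rightarrow> (nat \<Rightarrow> int)" where
  "torus_basis d n i = (\<lambda>j\<in>{..<d}. if j = i then 1 mod int n else 0)"

definition torus_generators :: "nat \<Rightarrow> nat \<Rightarrow> (nat \<Rightarrow> int) set" where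
  "torus_generators d n =
     (torus_basis d n ` {..<d} \<union> (\<lambda>i. inv\<^bsub>torus_group d n\<^esub> torus_basis d n i) ` {..<d})
     - {\<one>\<^bsub>torus_group d n\<^esub>}"

definition torus_edges :: "nat \<Rightarrow> nat \<Rightarrow> (nat \<Rightarrow> int) set set" where
  "torus_edges d n = cayley_edges (torus_group d n) (torus_generators d n)"

definition indep_count :: "nat \<Rightarrow> nat \<Rightarrow> nat" where
  "indep_count d n = card (independent_sets (carrier (torus_group d n)) (torus_edges d n))"

definition gamma :: "nat \<Rightarrow> nat \<Rightarrow> real" where
  "gamma d n = root (n ^ d) (real (indep_count d n))"

definition kappa :: "nat \<Rightarrow> real" where
  "kappa d = lim (\<lambda>n. gamma d n)"

definition real_field :: "real ring" where
  "real_field = \<lparr>carrier = UNIV, monoid.mult = (*), one = 1, ring.zero = 0, ring.add = (+)\<rparr>"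

text \<open>\<open>[\<rat>(x) : \<rat>]\<close>. The generated field contains the prime field \<open>\<rat>\<close>; \<open>ring.dim\<close> is only
  meaningful for extensions of finite degree, i.e. for algebraic \<open>x\<close>.\<close>

definition alg_degree :: "real \<Rightarrow> nat" where
  "alg_degree x = ring.dim real_field \<rat> (generate_field real_field {x})"

text \<open>For algebraic \<open>x\<close>, least degree together with content 1 and positive leading coefficient
  determines the polynomial uniquely, so the description operator is well defined.\<close>

definition int_min_poly :: "real \<Rightarrow> int poly" where
  "int_min_poly x = (THE p. content p = 1 \<and> lead_coeff p > 0 \<and> poly (of_int_poly p) x = 0 \<and>
     (\<forall>q. q \<noteq> 0 \<longrightarrow> poly (of_int_poly q) x = 0 \<longrightarrow> degree p \<le> degree q))"

text \<open>The library's \<open>mahler_measure p\<close> is the absolute value of the leading coefficient times the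
  product of \<open>max 1 (cmod z)\<close> over the complex roots \<open>z\<close> of \<open>p\<close>, which here are the conjugates.\<close>

definition weil_height :: "real \<Rightarrow> real" where
  "weil_height x = ln (mahler_measure (int_min_poly x)) / real (degree (int_min_poly x))"

end

theory Submission
  imports Defs "Jordan_Normal_Form.Determinant"
begin

text \<open>Deleting the hyperplanes \<open>x\<^sub>i \<equiv> 0 (mod n)\<close> from the torus of side \<open>m n\<close> leaves \<open>m\<^sup>d\<close> disjoint
  copies of the torus of side \<open>n\<close> with the hyperplanes \<open>x\<^sub>i = 0\<close> deleted, and a deletion of \<open>k\<close> vertices
  changes the number of independent sets by a factor between \<open>1\<close> and \<open>2\<^sup>k\<close>. Hence \<open>ln \<gamma>\<^sub>m\<^sub>n\<close> and \<open>ln \<gamma>\<^sub>n\<close>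
  differ by at most \<open>d ln 2 / n\<close>, so \<open>\<gamma>\<^sub>n\<close> converges with an explicit rate.
  The lower bounds are Liouville inequalities. If \<open>p\<close> is the minimal polynomial of \<open>\<kappa>\<close> and \<open>q\<close> is a monic
  integral polynomial with \<open>q(\<kappa>) \<noteq> 0\<close>, the resultant of \<open>p\<close> and \<open>q\<close> is a nonzero integer, so the
  product of the values of \<open>q\<close> at the conjugates of \<open>\<kappa>\<close> cannot be small. Part (1) takes
  \<open>q = X\<^sup>N - a\<^sub>d(n)\<close> with \<open>N = n\<^sup>d\<close>, part (2) the minimal polynomial of \<open>\<gamma>\<^sub>n\<close>, a factor of it.\<close>

section \<open>Independent sets of discrete tori\<close>

text \<open>Adjacency in the grid \<open>Z^d\<close>, with no reduction modulo \<open>n\<close>. On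
  stripped boxes it agrees with torus adjacency, so tori of different sides can be compared through
  it.\<close>

definition unit_step :: "nat \<Rightarrow> (nat \<Rightarrow> int) \<Rightarrow> (nat \<Rightarrow> int) \<Rightarrow> bool" where
  "unit_step d x y \<longleftrightarrow> (\<exists>i<d. \<bar>x i - y i\<bar> = 1 \<and> (\<forall>j<d. j \<noteq> i \<longrightarrow> x j = y j))"

text \<open>Independence is expressed by a relation on points instead of a set of edges, so that it
  can be transported along bijections and products.\<close>

definition free_sets :: "('a \<Rightarrow> 'a \<Rightarrow> bool) \<Rightarrow> 'a set \<Rightarrow> 'a set set" where
  "free_sets R U = {I. I \<subseteq> U \<and> (\<forall>x\<in>I. \<forall>y\<in>I. \<not> R x y)}"

lemma finite_free_sets: "finite U \<Longrightarrow> finite (free_sets R U)"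
  by (rule finite_subset[of _ "Pow U"]) (auto simp: free_sets_def)

lemma free_sets_nonempty: "{} \<in> free_sets R U"
  by (simp add: free_sets_def)

text \<open>Points in different fibres are never related, so a free set amounts to an arbitrary
  choice of one free subset of \<open>B\<close> for each \<open>q\<close> in
  \<open>A\<close>.\<close>

lemma card_free_sets_Times:
  assumes "finite A" "finite B"
  shows "card (free_sets (\<lambda>(p, r) (q, s). p = q \<and> R r s) (A \<times> B)) = card (free_sets R B) ^ card A"
proof -
  let ?F = "free_sets (\<lambda>(p, r) (q, s). p = q \<and> R r s) (A \<times> B)"
  have "bij_betw (\<lambda>I. \<lambda>q\<in>A. {r. (q, r) \<in> I}) ?F (PiE A (\<lambda>_. free_sets R B))"
  proof (rule bij_betw_byWitness[where f' = "\<lambda>f. {(q, r). q \<in> A \<and> r \<in> f q}"])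
    show "\<forall>I\<in>?F. {(q, r). q \<in> A \<and> r \<in> (\<lambda>q\<in>A. {r. (q, r) \<in> I}) q} = I"
    proof
      fix I assume "I \<in> ?F"
      then have "I \<subseteq> A \<times> B" by (simp add: free_sets_def)
      then show "{(q, r). q \<in> A \<and> r \<in> (\<lambda>q\<in>A. {r. (q, r) \<in> I}) q} = I" by auto
    qed
    show "\<forall>f\<in>PiE A (\<lambda>_. free_sets R B). (\<lambda>q\<in>A. {r. (q, r) \<in> {(q, r). q \<in> A \<and> r \<in> f q}}) = f"
    proof (intro ballI ext)
      fix f q assume "f \<in> PiE A (\<lambda>_. free_sets R B)"
      then show "(\<lambda>q\<in>A. {r. (q, r) \<in> {(q, r). q \<in> A \<and> r \<in> f q}}) q = f q"
        by (cases "q \<in> A") (simp_all add: PiE_arb[of f A "\<lambda>_. free_sets R B"])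
    qed
    show "(\<lambda>I. \<lambda>q\<in>A. {r. (q, r) \<in> I}) ` ?F \<subseteq> PiE A (\<lambda>_. free_sets R B)"
    proof (intro image_subsetI PiE_I)
      fix I q assume I: "I \<in> ?F" and q: "q \<in> A"
      have "\<not> R r s" if "(q, r) \<in> I" "(q, s) \<in> I" for r s
        using I that unfolding free_sets_def by blast
      moreover have "{r. (q, r) \<in> I} \<subseteq> B" using I unfolding free_sets_def by blast
      ultimately show "(\<lambda>q\<in>A. {r. (q, r) \<in> I}) q \<in> free_sets R B"
        using q by (simp add: free_sets_def)
    qed simp
    show "(\<lambda>f. {(q, r). q \<in> A \<and> r \<in> f q}) ` PiE A (\<lambda>_. free_sets R B) \<subseteq> ?F"
    proof (rule image_subsetI)
      fix f assume f: "f \<in> PiE A (\<lambda>_. free_sets R B)"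
      have "f q \<subseteq> B" "\<And>r s. r \<in> f q \<Longrightarrow> s \<in> f q \<Longrightarrow> \<not> R r s" if "q \<in> A" for q
        using PiE_mem[OF f that] by (auto simp: free_sets_def)
      then show "{(q, r). q \<in> A \<and> r \<in> f q} \<in> ?F"
        unfolding free_sets_def by blast
    qed
  qed
  then show ?thesis
    using assms by (simp add: bij_betw_same_card card_PiE)
qed

lemma card_free_sets_bij:
  assumes "bij_betw f A B" and "\<And>x y. x \<in> A \<Longrightarrow> y \<in> A \<Longrightarrow> R x y \<longleftrightarrow> S (f x) (f y)"
  shows "card (free_sets R A) = card (free_sets S B)"
proof -
  have "bij_betw ((`) f) (Pow A) (Pow B)"
    using assms(1) by (rule bij_betw_Pow)
  then have "bij_betw ((`) f) (free_sets R A) (free_sets S B)"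
  proof (rule bij_betw_subset)
    show "free_sets R A \<subseteq> Pow A" by (auto simp: free_sets_def)
    show "(`) f ` free_sets R A = free_sets S B"
    proof (intro equalityI subsetI)
      fix J assume "J \<in> (`) f ` free_sets R A"
      then obtain I where I: "I \<subseteq> A" "\<And>x y. x \<in> I \<Longrightarrow> y \<in> I \<Longrightarrow> \<not> R x y" and J: "J = f ` I"
        by (auto simp: free_sets_def)
      have "\<not> S (f x) (f y)" if "x \<in> I" "y \<in> I" for x y
        using that I assms(2)[of x y] by blast
      moreover have "J \<subseteq> B"
        using I J assms(1) by (auto simp: bij_betw_def)
      ultimately show "J \<in> free_sets S B"
        using J by (auto simp: free_sets_def)
    next
      fix J assume J: "J \<in> free_sets S B"
      then have "J \<subseteq> f ` A"
        using assms(1) by (simp add: free_sets_def bij_betw_def)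
      then obtain I where I: "I \<subseteq> A" "J = f ` I" by (auto simp: subset_image_iff)
      have "\<not> R x y" if "x \<in> I" "y \<in> I" for x y
        using that I J assms(2)[of x y] by (auto simp: free_sets_def)
      then have "I \<in> free_sets R A"
        using I by (simp add: free_sets_def)
      then show "J \<in> (`) f ` free_sets R A" using I by auto
    qed
  qed
  then show ?thesis by (rule bij_betw_same_card)
qed

text \<open>An independent set is determined by its traces on \<open>U\<close> and on the complement of \<open>U\<close>.\<close>

lemma card_independent_sets_restrict:
  fixes E :: "'a set set"
  assumes "finite V" "U \<subseteq> V"
  defines "S \<equiv> independent_sets V E \<inter> Pow U"
  shows "card S \<le> card (independent_sets V E)"
    and "card (independent_sets V E) \<le> 2 ^ card (V - U) * card S"
proof -
  have fin: "finite (independent_sets V E)"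
    by (rule finite_subset[of _ "Pow V"]) (use assms(1) in \<open>auto simp: independent_sets_def\<close>)
  show "card S \<le> card (independent_sets V E)"
    unfolding S_def by (rule card_mono) (use fin in auto)
  have "card (independent_sets V E) \<le> card (Pow (V - U) \<times> S)"
  proof (rule card_inj_on_le[where f = "\<lambda>I. (I - U, I \<inter> U)"])
    show "inj_on (\<lambda>I. (I - U, I \<inter> U)) (independent_sets V E)"
      by (rule inj_onI) (metis Int_Diff_Un Pair_inject)
    show "(\<lambda>I. (I - U, I \<inter> U)) ` independent_sets V E \<subseteq> Pow (V - U) \<times> S"
      by (auto simp: independent_sets_def S_def)
    show "finite (Pow (V - U) \<times> S)"
      using fin assms(1) by (simp add: S_def)
  qed
  then show "card (independent_sets V E) \<le> 2 ^ card (V - U) * card S"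
    using assms(1) by (simp add: card_cartesian_product card_Pow)
qed

section \<open>Coordinates on the torus and deletion of the zero hyperplanes\<close>

lemma carrier_torus_group:
  "n \<ge> 1 \<Longrightarrow> carrier (torus_group d n) = PiE {..<d} (\<lambda>_. {0..<int n})"
  by (simp add: torus_group_def carrier_integer_mod_group)

text \<open>Residues are represented in \<open>{0..<n}\<close>, so starting at 1 deletes exactly the
  hyperplanes \<open>x i = 0\<close>.\<close>

definition stripped_box :: "nat \<Rightarrow> nat \<Rightarrow> (nat \<Rightarrow> int) set" where
  "stripped_box d n = PiE {..<d} (\<lambda>_. {1..<int n})"

lemma stripped_box_subset_carrier: "n \<ge> 1 \<Longrightarrow> stripped_box d n \<subseteq> carrier (torus_group d n)"
  by (simp add: stripped_box_def carrier_torus_group, rule PiE_mono) auto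

lemma torus_group_mult:
  "x \<otimes>\<^bsub>torus_group d n\<^esub> y = (\<lambda>i\<in>{..<d}. (x i + y i) mod int n)"
  by (simp add: torus_group_def)

lemma torus_basis_in_carrier: "n \<ge> 1 \<Longrightarrow> torus_basis d n i \<in> carrier (torus_group d n)"
  by (auto simp: carrier_torus_group torus_basis_def)

lemma inv_torus_basis:
  assumes "n \<ge> 1"
  shows "inv\<^bsub>torus_group d n\<^esub> torus_basis d n i = (\<lambda>j\<in>{..<d}. if j = i then (-1) mod int n else 0)"
proof -
  have "inv\<^bsub>torus_group d n\<^esub> torus_basis d n i = (\<lambda>j\<in>{..<d}. inv\<^bsub>integer_mod_group n\<^esub> (torus_basis d n i j))"
    using torus_basis_in_carrier[OF assms, of d i] unfolding torus_group_def
    by (intro inv_product_group) (auto simp: carrier_product_group)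
  also have "\<dots> = (\<lambda>j\<in>{..<d}. if j = i then (-1) mod int n else 0)"
    using assms by (auto simp: torus_basis_def fun_eq_iff carrier_integer_mod_group mod_minus_eq)
  finally show ?thesis .
qed

lemma unit_step_commute: "unit_step d x y \<longleftrightarrow> unit_step d y x"
  by (auto simp: unit_step_def abs_minus_commute)

text \<open>The sums have the form produced by the two kinds of generators, whose nonzero coordinate
  is \<open>1 mod n\<close> or \<open>(-1) mod n\<close>.\<close>

lemma mod_pred_succ:
  fixes a n :: int
  assumes "1 \<le> a" "a < n"
  shows "(a + 1 mod n) mod n = (if a = n - 1 then 0 else a + 1)" "(a + (-1) mod n) mod n = a - 1"
  using assms by (auto simp: mod_simps)

text \<open>Steps that wrap around pass through a point with a zero coordinate.\<close>

lemma torus_edge_iff_unit_step: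
  assumes "n \<ge> 1" and x: "x \<in> PiE {..<d} (\<lambda>_. {1..<int n})" and y: "y \<in> PiE {..<d} (\<lambda>_. {1..<int n})"
  shows "{x, y} \<in> torus_edges d n \<longleftrightarrow> unit_step d x y"
proof -
  let ?W = "PiE {..<d} (\<lambda>_. {1..<int n})"
  let ?G = "torus_group d n"
  have step: "unit_step d u v"
    if u: "u \<in> ?W" and v: "v \<in> ?W" and s: "s \<in> torus_generators d n" and eq: "v = u \<otimes>\<^bsub>?G\<^esub> s" for u v s
  proof -
    obtain i where i: "i < d" and "s = torus_basis d n i \<or> s = inv\<^bsub>?G\<^esub> torus_basis d n i"
      using s by (auto simp: torus_generators_def)
    have mod: "u j mod int n = u j" if "j < d" for j
      using PiE_mem[OF u, of j] that by (intro mod_pos_pos_trivial) auto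
    from \<open>s = _ \<or> s = _\<close> consider "s = (\<lambda>j\<in>{..<d}. if j = i then 1 mod int n else 0)"
      | "s = (\<lambda>j\<in>{..<d}. if j = i then (-1) mod int n else 0)"
      using inv_torus_basis[OF assms(1)] torus_basis_def by metis
    then have "\<bar>u i - v i\<bar> = 1 \<and> (\<forall>j<d. j \<noteq> i \<longrightarrow> u j = v j)"
    proof cases
      case 1
      \<comment> \<open>\<open>1 \<le> v i\<close> excludes 0, the value reached by wrapping around
        from \<open>n - 1\<close>.\<close>
      have "1 \<le> v i" "1 \<le> u i" "u i < n" using u v i by (auto simp: PiE_iff)
      moreover have "v i = (u i + 1 mod int n) mod int n"
        using i by (simp add: eq torus_group_mult 1)
      ultimately have "v i = u i + 1" using mod_pred_succ(1)[of "u i" "int n"] by (metis not_one_le_zero)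
      moreover have "v j = u j" if "j < d" "j \<noteq> i" for j
        using that mod by (simp add: eq torus_group_mult 1)
      ultimately show ?thesis by simp
    next
      case 2
      have "1 \<le> u i" "u i < n" using u i by (auto simp: PiE_iff)
      moreover have "v i = (u i + (-1) mod int n) mod int n"
        using i by (simp add: eq torus_group_mult 2)
      ultimately have "v i = u i - 1" by (simp only: mod_pred_succ)
      moreover have "v j = u j" if "j < d" "j \<noteq> i" for j
        using that mod by (simp add: eq torus_group_mult 2)
      ultimately show ?thesis by simp
    qed
    then show ?thesis using i by (auto simp: unit_step_def)
  qed
  show ?thesis
  proof
    assume "{x, y} \<in> torus_edges d n"
    then obtain u s where "{x, y} = {u, u \<otimes>\<^bsub>?G\<^esub> s}" and s: "s \<in> torus_generators d n"
      by (auto simp: torus_edges_def cayley_edges_def)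
    then have "(x = u \<and> y = u \<otimes>\<^bsub>?G\<^esub> s) \<or> (y = u \<and> x = u \<otimes>\<^bsub>?G\<^esub> s)"
      by (auto simp: doubleton_eq_iff)
    then show "unit_step d x y"
      using step[OF _ _ s] x y unit_step_commute by metis
  next
    assume "unit_step d x y"
    then obtain i where i: "i < d" "\<bar>x i - y i\<bar> = 1" and eq: "\<And>j. j < d \<Longrightarrow> j \<noteq> i \<Longrightarrow> x j = y j"
      by (auto simp: unit_step_def)
    have xi: "1 \<le> x i" "x i < n" and yi: "1 \<le> y i" "y i < n" using x y i by (auto simp: PiE_iff)
    define s where "s = (if y i = x i + 1 then torus_basis d n i else inv\<^bsub>?G\<^esub> torus_basis d n i)"
    have s_app: "s = (\<lambda>j\<in>{..<d}. if j = i then (if y i = x i + 1 then 1 else -1) mod int n else 0)"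
      by (cases "y i = x i + 1") (simp_all add: s_def inv_torus_basis[OF assms(1)], simp add: torus_basis_def)
    have mod_step: "(x j + s j) mod int n = y j" if "j < d" for j
    proof (cases "j = i")
      case True
      then show ?thesis
        using i xi yi mod_pred_succ[OF xi] by (auto simp: s_app split: if_splits)
    next
      case False
      have "y j \<in> {1..<int n}" using PiE_mem[OF y, of j] that by simp
      then have "y j mod int n = y j" by (intro mod_pos_pos_trivial) auto
      then show ?thesis using that False eq[OF that False] by (simp add: s_app)
    qed
    then have xy: "x \<otimes>\<^bsub>?G\<^esub> s = y"
      using y by (auto simp: torus_group_mult fun_eq_iff PiE_iff extensional_def)
    \<comment> \<open>\<open>torus_generators\<close> omits the identity, so \<open>s\<close> must
      be shown to differ from it; it does because it moves coordinate \<open>i\<close>.\<close>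
    have "s i \<noteq> 0"
    proof
      assume "s i = 0"
      then have "x i = y i" using mod_step[OF i(1)] xi by simp
      then show False using i by simp
    qed
    then have "s \<noteq> \<one>\<^bsub>?G\<^esub>" using i by (auto simp: torus_group_def)
    then have "s \<in> torus_generators d n" using i by (auto simp: torus_generators_def s_def)
    moreover have "x \<in> carrier ?G"
      using x stripped_box_subset_carrier[OF assms(1)] by (auto simp: stripped_box_def)
    ultimately have "{x, x \<otimes>\<^bsub>?G\<^esub> s} \<in> torus_edges d n"
      unfolding torus_edges_def cayley_edges_def by blast
    then show "{x, y} \<in> torus_edges d n" by (simp only: xy)
  qed
qed

definition stripped_count :: "nat \<Rightarrow> nat \<Rightarrow> nat" where
  "stripped_count d n = card (free_sets (unit_step d) (stripped_box d n))"

lemma card_stripped_box: "n \<ge> 1 \<Longrightarrow> card (stripped_box d n) = (n - 1) ^ d"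
  by (simp add: stripped_box_def card_PiE nat_diff_distrib)

lemma stripped_count_pos: "stripped_count d n > 0"
proof -
  have "finite (stripped_box d n)" unfolding stripped_box_def by (intro finite_PiE) auto
  then show ?thesis
    unfolding stripped_count_def using free_sets_nonempty finite_free_sets by (metis card_gt_0_iff empty_iff)
qed

text \<open>If both endpoints of a torus edge lie in \<open>I\<close>, they lie in the stripped box,
  where torus edges are exactly unit steps. For fixed \<open>U\<close> the right-hand side no longer
  mentions \<open>n\<close>.\<close>

lemma independent_torus_Int_Pow:
  assumes "n \<ge> 1" and U: "U \<subseteq> stripped_box d n"
  shows "independent_sets (carrier (torus_group d n)) (torus_edges d n) \<inter> Pow U = free_sets (unit_step d) U"
proof (intro equalityI subsetI)
  fix I assume "I \<in> independent_sets (carrier (torus_group d n)) (torus_edges d n) \<inter> Pow U"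
  then have I: "I \<subseteq> U" and *: "\<And>e. e \<in> torus_edges d n \<Longrightarrow> \<not> e \<subseteq> I"
    by (auto simp: independent_sets_def)
  have "\<not> unit_step d x y" if "x \<in> I" "y \<in> I" for x y
  proof -
    have "x \<in> stripped_box d n" "y \<in> stripped_box d n" using that I U by auto
    then show ?thesis
      using *[of "{x, y}"] that torus_edge_iff_unit_step[OF assms(1)] by (auto simp: stripped_box_def)
  qed
  then show "I \<in> free_sets (unit_step d) U" using I by (simp add: free_sets_def)
next
  fix I assume "I \<in> free_sets (unit_step d) U"
  then have I: "I \<subseteq> U" and *: "\<And>x y. x \<in> I \<Longrightarrow> y \<in> I \<Longrightarrow> \<not> unit_step d x y"
    by (auto simp: free_sets_def)
  have "\<not> e \<subseteq> I" if e: "e \<in> torus_edges d n" for e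
  proof
    assume "e \<subseteq> I"
    obtain x y where xy: "e = {x, y}" using e unfolding torus_edges_def cayley_edges_def by blast
    have "x \<in> I" "y \<in> I" using \<open>e \<subseteq> I\<close> xy by auto
    moreover from this have "x \<in> stripped_box d n" "y \<in> stripped_box d n" using I U by auto
    ultimately show False
      using * e torus_edge_iff_unit_step[OF assms(1)] unfolding xy stripped_box_def by blast
  qed
  moreover note stripped_box_subset_carrier[OF assms(1), of d]
  ultimately show "I \<in> independent_sets (carrier (torus_group d n)) (torus_edges d n) \<inter> Pow U"
    using I U by (auto simp: independent_sets_def)
qed

lemma indep_count_bounds:
  assumes "n \<ge> 1" and U: "U \<subseteq> stripped_box d n"
  shows "card (free_sets (unit_step d) U) \<le> indep_count d n"
    and "indep_count d n \<le> 2 ^ (n ^ d - card U) * card (free_sets (unit_step d) U)"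
proof -
  let ?V = "carrier (torus_group d n)"
  have V: "finite ?V" "card ?V = n ^ d"
    using assms(1) by (auto simp: carrier_torus_group card_PiE intro!: finite_PiE)
  have UV: "U \<subseteq> ?V" using U stripped_box_subset_carrier[OF assms(1), of d] by auto
  then have "card (?V - U) = n ^ d - card U"
    using V by (simp add: card_Diff_subset finite_subset)
  then show "card (free_sets (unit_step d) U) \<le> indep_count d n"
    and "indep_count d n \<le> 2 ^ (n ^ d - card U) * card (free_sets (unit_step d) U)"
    using card_independent_sets_restrict[OF V(1) UV, of "torus_edges d n"]
    unfolding independent_torus_Int_Pow[OF assms] indep_count_def by simp_all
qed

section \<open>Decomposition of a large torus into blocks\<close>

definition glue :: "nat \<Rightarrow> nat \<Rightarrow> (nat \<Rightarrow> int) \<times> (nat \<Rightarrow> int) \<Rightarrow> (nat \<Rightarrow> int)" where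
  "glue d n = (\<lambda>(q, r). \<lambda>i\<in>{..<d}. q i * int n + r i)"

text \<open>As \<open>0 < r i < n\<close>, the glued coordinate is a Euclidean division by
  \<open>n\<close>: \<open>q\<close> names the block and \<open>r\<close> the position inside
  it.\<close>

lemma glue_coordinate:
  assumes "r \<in> stripped_box d n" "i < d"
  shows "glue d n (q, r) i div int n = q i" "glue d n (q, r) i mod int n = r i"
proof -
  have "0 < r i" "r i < int n" using PiE_mem[OF assms(1)[unfolded stripped_box_def], of i] assms(2) by auto
  then show "glue d n (q, r) i div int n = q i" "glue d n (q, r) i mod int n = r i"
    using assms(2) by (simp_all add: glue_def div_pos_pos_trivial mod_pos_pos_trivial)
qed

text \<open>With remainders between \<open>1\<close> and \<open>n - 1\<close>, a multiple of
  \<open>n\<close> lies strictly between points of different blocks, so they are at least 2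
  apart.\<close>

lemma same_block_if_adjacent:
  fixes q q' r r' n :: int
  assumes "\<bar>(q * n + r) - (q' * n + r')\<bar> = 1" "1 \<le> r" "r < n" "1 \<le> r'" "r' < n"
  shows "q = q'"
proof (rule ccontr)
  assume "q \<noteq> q'"
  then consider "q \<ge> q' + 1" | "q' \<ge> q + 1" by linarith
  then show False
  proof cases
    case 1
    then have "q * n \<ge> (q' + 1) * n" using assms by (intro mult_right_mono) auto
    then show ?thesis using assms by (simp add: algebra_simps)
  next
    case 2
    then have "q' * n \<ge> (q + 1) * n" using assms by (intro mult_right_mono) auto
    then show ?thesis using assms by (simp add: algebra_simps)
  qed
qed

text \<open>The moving coordinate stays in its block by \<open>same_block_if_adjacent\<close>; the
  equal coordinates have equal quotients and remainders. So the blocks carry copies of one grid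
  graph with no edges between them.\<close>

lemma unit_step_glue:
  assumes q: "q \<in> PiE {..<d} (\<lambda>_. {0..<int m})" "q' \<in> PiE {..<d} (\<lambda>_. {0..<int m})"
    and r: "r \<in> stripped_box d n" "r' \<in> stripped_box d n"
  shows "unit_step d (glue d n (q, r)) (glue d n (q', r')) \<longleftrightarrow> q = q' \<and> unit_step d r r'"
proof
  let ?x = "glue d n (q, r)" and ?y = "glue d n (q', r')"
  assume "unit_step d ?x ?y"
  then obtain i where i: "i < d" "\<bar>?x i - ?y i\<bar> = 1" and eq: "\<And>j. j < d \<Longrightarrow> j \<noteq> i \<Longrightarrow> ?x j = ?y j"
    by (auto simp: unit_step_def)
  have bnd: "1 \<le> r i" "r i < int n" "1 \<le> r' i" "r' i < int n"
    using PiE_mem[OF r(1)[unfolded stripped_box_def], of i] PiE_mem[OF r(2)[unfolded stripped_box_def], of i] i(1) by auto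
  have qi: "q i = q' i"
    using same_block_if_adjacent[OF _ bnd, of "q i" "q' i"] i by (simp add: glue_def)
  have "q j = q' j" if "j < d" for j
  proof (cases "j = i")
    case False
    then show ?thesis
      using glue_coordinate(1)[OF r(1) that, of q] glue_coordinate(1)[OF r(2) that, of q'] eq[OF that] by simp
  qed (simp add: qi)
  then have "q = q'" using PiE_ext[OF q] by simp
  moreover have "\<bar>r i - r' i\<bar> = 1" using i qi by (simp add: glue_def)
  moreover have "r j = r' j" if "j < d" "j \<noteq> i" for j
    using glue_coordinate(2)[OF r(1) that(1), of q] glue_coordinate(2)[OF r(2) that(1), of q'] eq[OF that] by simp
  ultimately show "q = q' \<and> unit_step d r r'" using i(1) by (auto simp: unit_step_def)
next
  assume *: "q = q' \<and> unit_step d r r'"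
  then obtain i where "i < d" "\<bar>r i - r' i\<bar> = 1" "\<And>j. j < d \<Longrightarrow> j \<noteq> i \<Longrightarrow> r j = r' j"
    by (auto simp: unit_step_def)
  then show "unit_step d (glue d n (q, r)) (glue d n (q', r'))"
    using * unfolding unit_step_def by (intro exI[of _ i]) (simp add: glue_def)
qed

lemma glue_image_stripped:
  fixes d :: nat
  assumes "m \<ge> 1" "n \<ge> 1"
  defines "Q \<equiv> PiE {..<d} (\<lambda>_. {0..<int m})"
  shows "inj_on (glue d n) (Q \<times> stripped_box d n)"
    and "glue d n ` (Q \<times> stripped_box d n) \<subseteq> stripped_box d (m * n)"
proof -
  show "inj_on (glue d n) (Q \<times> stripped_box d n)"
  proof (rule inj_onI; clarify)
    fix q r q' r'
    assume q: "q \<in> Q" "q' \<in> Q" and r: "r \<in> stripped_box d n" "r' \<in> stripped_box d n"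
      and eq: "glue d n (q, r) = glue d n (q', r')"
    have "q j = q' j" "r j = r' j" if "j < d" for j
      using glue_coordinate[OF r(1) that, of q] glue_coordinate[OF r(2) that, of q'] eq by auto
    then show "q = q' \<and> r = r'"
      using PiE_ext[of q "{..<d}" "\<lambda>_. {0..<int m}" q'] PiE_ext[of r "{..<d}" "\<lambda>_. {1..<int n}" r'] q r
      by (simp add: Q_def stripped_box_def)
  qed
  show "glue d n ` (Q \<times> stripped_box d n) \<subseteq> stripped_box d (m * n)"
  proof (rule image_subsetI; clarify)
    fix q r assume q: "q \<in> Q" and r: "r \<in> stripped_box d n"
    have "1 \<le> q i * int n + r i \<and> q i * int n + r i < int m * int n" if "i < d" for i
    proof -
      have qi: "0 \<le> q i" "q i + 1 \<le> int m" using PiE_mem[OF q[unfolded Q_def], of i] that by auto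
      have ri: "1 \<le> r i" "r i < int n" using PiE_mem[OF r[unfolded stripped_box_def], of i] that by auto
      have "(q i + 1) * int n \<le> int m * int n" using qi by (intro mult_right_mono) auto
      moreover have "0 \<le> q i * int n" using qi by simp
      ultimately show ?thesis using ri by (simp add: algebra_simps)
    qed
    then show "glue d n (q, r) \<in> stripped_box d (m * n)"
      by (simp add: glue_def stripped_box_def)
  qed
qed

text \<open>\<open>U\<close> is the torus of side \<open>m * n\<close> without the hyperplanes on
  which a coordinate is divisible by \<open>n\<close>. It consists of \<open>m ^ d\<close> mutually
  non-adjacent copies of \<open>stripped_box d n\<close>, which makes the count a power, and each
  deleted vertex costs at most a factor 2.\<close>

lemma indep_count_mult_bounds:
  assumes "m \<ge> 1" "n \<ge> 1"
  shows "stripped_count d n ^ (m ^ d) \<le> indep_count d (m * n)"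
    and "indep_count d (m * n) \<le> 2 ^ (m ^ d * (n ^ d - (n - 1) ^ d)) * stripped_count d n ^ (m ^ d)"
proof -
  define Q where "Q = PiE {..<d} (\<lambda>_. {0..<int m})"
  define U where "U = glue d n ` (Q \<times> stripped_box d n)"
  have Q: "finite Q" "card Q = m ^ d" by (auto simp: Q_def card_PiE intro!: finite_PiE)
  have B: "finite (stripped_box d n)" unfolding stripped_box_def by (intro finite_PiE) auto
  have bij: "bij_betw (glue d n) (Q \<times> stripped_box d n) U"
    unfolding U_def using glue_image_stripped(1)[OF assms, of d] by (auto simp: Q_def intro: inj_on_imp_bij_betw)
  have "card (free_sets (unit_step d) U)
      = card (free_sets (\<lambda>(q, r) (q', r'). q = q' \<and> unit_step d r r') (Q \<times> stripped_box d n))"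
  proof (rule sym, rule card_free_sets_bij[OF bij], clarify)
    fix q r q' r' assume "q \<in> Q" "r \<in> stripped_box d n" "q' \<in> Q" "r' \<in> stripped_box d n"
    then show "(q = q' \<and> unit_step d r r') = unit_step d (glue d n (q, r)) (glue d n (q', r'))"
      using unit_step_glue[of q d m q' r n r'] by (simp add: Q_def)
  qed
  then have free: "card (free_sets (unit_step d) U) = stripped_count d n ^ (m ^ d)"
    using Q B by (simp add: card_free_sets_Times stripped_count_def)
  have "card U = m ^ d * (n - 1) ^ d"
    using bij_betw_same_card[OF bij] Q assms(2) by (simp add: card_cartesian_product card_stripped_box)
  then have "(m * n) ^ d - card U = m ^ d * (n ^ d - (n - 1) ^ d)"
    by (simp add: power_mult_distrib diff_mult_distrib2)
  then show "stripped_count d n ^ (m ^ d) \<le> indep_count d (m * n)"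
    and "indep_count d (m * n) \<le> 2 ^ (m ^ d * (n ^ d - (n - 1) ^ d)) * stripped_count d n ^ (m ^ d)"
    using indep_count_bounds[of "m * n" U d] glue_image_stripped(2)[OF assms, of d] assms
    unfolding free by (simp_all add: U_def Q_def)
qed

text \<open>This is the extreme case in which all vertices are deleted,
  \<open>U = {}\<close>.\<close>

lemma indep_count_trivial_bounds:
  assumes "n \<ge> 1"
  shows "1 \<le> indep_count d n" "indep_count d n \<le> 2 ^ (n ^ d)"
proof -
  have "free_sets (unit_step d) {} = {{}}" by (auto simp: free_sets_def)
  then show "1 \<le> indep_count d n" "indep_count d n \<le> 2 ^ (n ^ d)"
    using indep_count_bounds[OF assms, of "{}" d] by simp_all
qed

section \<open>Convergence of \<open>gamma\<close> with an explicit rate\<close>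

lemma gamma_power:
  assumes "n \<ge> 1"
  shows "gamma d n ^ (n ^ d) = real (indep_count d n)"
  using assms by (simp add: gamma_def)

lemma ln_gamma: "n \<ge> 1 \<Longrightarrow> ln (gamma d n) = ln (real (indep_count d n)) / real (n ^ d)"
  using indep_count_trivial_bounds(1)[of n d] by (simp add: gamma_def ln_root)

lemma gamma_bounds:
  assumes "n \<ge> 1"
  shows "1 \<le> gamma d n" "gamma d n \<le> 2"
proof -
  have n: "n ^ d > 0" using assms by simp
  show "1 \<le> gamma d n"
    using indep_count_trivial_bounds(1)[OF assms, of d] n by (simp add: gamma_def)
  have "real (indep_count d n) \<le> 2 ^ (n ^ d)"
    using of_nat_mono[OF indep_count_trivial_bounds(2)[OF assms, of d], where 'a = real] by simp
  then have "gamma d n \<le> root (n ^ d) (2 ^ (n ^ d))"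
    unfolding gamma_def using n by (simp del: of_nat_power)
  also have "\<dots> = 2" using n by (simp add: real_root_power_cancel)
  finally show "gamma d n \<le> 2" .
qed

text \<open>The left-hand side is the proportion of deleted vertices,
  \<open>1 - (1 - 1/n) ^ d\<close>, and Bernoulli's inequality bounds it.\<close>

lemma boundary_fraction_le:
  assumes "n \<ge> 1"
  shows "real (n ^ d - (n - 1) ^ d) / real (n ^ d) \<le> real d / real n"
proof -
  have le: "(n - 1) ^ d \<le> n ^ d" by (intro power_mono) auto
  have "1 + real d * (- 1 / real n) \<le> (1 + (- 1 / real n)) ^ d"
    by (rule Bernoulli_inequality) (use assms in \<open>simp add: field_simps\<close>)
  moreover have "1 + (- 1 / real n) = real (n - 1) / real n"
    using assms by (simp add: of_nat_diff field_simps)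
  ultimately have "1 - real d / real n \<le> real (n - 1) ^ d / real n ^ d"
    by (simp add: power_divide)
  then show ?thesis
    using assms le by (simp add: of_nat_diff field_simps)
qed

text \<open>Both \<open>ln (indep_count d (m * n))\<close> and
  \<open>M * ln (indep_count d n)\<close> lie between \<open>M * ln s\<close> and
  \<open>M * ln s + M * K * ln 2\<close>; division by \<open>M * n ^ d\<close> leaves
  \<open>K / n ^ d\<close>, the boundary fraction.\<close>

lemma ln_gamma_multiple:
  assumes "m \<ge> 1" "n \<ge> 1"
  shows "\<bar>ln (gamma d (m * n)) - ln (gamma d n)\<bar> \<le> real d * ln 2 / real n"
proof -
  define s where "s = real (stripped_count d n)"
  define M where "M = real (m ^ d)"
  define K where "K = n ^ d - (n - 1) ^ d"
  have s: "s > 0" using stripped_count_pos by (simp add: s_def)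
  have M: "M > 0" using assms by (simp add: M_def)
  \<comment> \<open>\<open>k\<close> is a parameter because the bound is applied with
    \<open>k = m ^ d\<close> for side \<open>m * n\<close> and with \<open>k = 1\<close> for side
    \<open>n\<close>.\<close>
  have bnd: "real k * ln s \<le> ln (real a)" "ln (real a) \<le> real (k * K) * ln 2 + real k * ln s"
    if "stripped_count d n ^ k \<le> a" "a \<le> 2 ^ (k * K) * stripped_count d n ^ k" for a k
  proof -
    have 1: "s ^ k \<le> real a" unfolding s_def using of_nat_mono[OF that(1), where 'a = real] by simp
    have 2: "real a \<le> 2 ^ (k * K) * s ^ k"
      unfolding s_def using of_nat_mono[OF that(2), where 'a = real] by simp
    have "0 < s ^ k" using s by simp
    then have "0 < real a" using 1 by linarith
    then have "ln (s ^ k) \<le> ln (real a)" "ln (real a) \<le> ln (2 ^ (k * K) * s ^ k)"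
      using 1 2 \<open>0 < s ^ k\<close> by (simp_all del: ln_le_cancel_iff add: ln_mono)
    then show "real k * ln s \<le> ln (real a)" "ln (real a) \<le> real (k * K) * ln 2 + real k * ln s"
      using s by (simp_all add: ln_mult ln_realpow)
  qed
  have 1: "M * ln s \<le> ln (real (indep_count d (m * n)))"
      "ln (real (indep_count d (m * n))) \<le> M * real K * ln 2 + M * ln s"
    using bnd[OF indep_count_mult_bounds[OF assms, of d, folded K_def]] by (simp_all add: M_def)
  have 2: "ln s \<le> ln (real (indep_count d n))" "ln (real (indep_count d n)) \<le> real K * ln 2 + ln s"
    using bnd[of 1 "indep_count d n"] indep_count_mult_bounds[OF order.refl assms(2), of d, folded K_def] by simp_all
  have "M * ln s \<le> M * ln (real (indep_count d n))" "M * ln (real (indep_count d n)) \<le> M * (real K * ln 2 + ln s)"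
    using 2 M by simp_all
  then have "\<bar>ln (real (indep_count d (m * n))) - M * ln (real (indep_count d n))\<bar> \<le> M * real K * ln 2"
    using 1 by (simp add: abs_le_iff algebra_simps)
  then have "\<bar>ln (real (indep_count d (m * n))) - M * ln (real (indep_count d n))\<bar> / (M * real (n ^ d))
      \<le> M * real K * ln 2 / (M * real (n ^ d))"
    using M by (intro divide_right_mono) auto
  also have "\<bar>ln (real (indep_count d (m * n))) - M * ln (real (indep_count d n))\<bar> / (M * real (n ^ d))
      = \<bar>ln (gamma d (m * n)) - ln (gamma d n)\<bar>"
  proof -
    have "ln (gamma d (m * n)) - ln (gamma d n)
        = (ln (real (indep_count d (m * n))) - M * ln (real (indep_count d n))) / (M * real (n ^ d))"
      using M assms by (simp add: ln_gamma M_def power_mult_distrib diff_divide_distrib)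
    then show ?thesis using M by (simp add: abs_divide)
  qed
  also have "M * real K * ln 2 / (M * real (n ^ d)) = real K / real (n ^ d) * ln 2"
    using M by simp
  also have "\<dots> \<le> real d / real n * ln 2"
    unfolding K_def by (intro mult_right_mono boundary_fraction_le assms) simp
  finally show ?thesis by simp
qed

text \<open>Both terms are compared with \<open>gamma d (m * n)\<close>.\<close>

lemma ln_gamma_diff_le:
  assumes "m \<ge> 1" "n \<ge> 1"
  shows "\<bar>ln (gamma d m) - ln (gamma d n)\<bar> \<le> real d * ln 2 / real m + real d * ln 2 / real n"
  using ln_gamma_multiple[OF assms, of d] ln_gamma_multiple[OF assms(2,1), of d]
  by (simp add: mult.commute[of m n])

text \<open>The logarithms form a Cauchy sequence by \<open>ln_gamma_diff_le\<close>, so the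
  \<open>lim\<close> in \<open>kappa\<close> is a true limit.\<close>

lemma kappa_limit:
  shows "(\<lambda>n. gamma d n) \<longlonglongrightarrow> kappa d"
    and "kappa d > 0"
    and "n \<ge> 1 \<Longrightarrow> \<bar>ln (gamma d n) - ln (kappa d)\<bar> \<le> real d * ln 2 / real n"
proof -
  define C where "C = real d * ln 2"
  have "C \<ge> 0" by (simp add: C_def)
  have diff: "\<bar>ln (gamma d m) - ln (gamma d n)\<bar> \<le> C / real m + C / real n" if "m \<ge> 1" "n \<ge> 1" for m n
    using ln_gamma_diff_le[OF that] by (simp add: C_def)
  have "Cauchy (\<lambda>n. ln (gamma d n))"
  proof (rule metric_CauchyI)
    fix e :: real assume "e > 0"
    \<comment> \<open>Beyond this \<open>N\<close> each of the two error terms is below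
      \<open>e / 2\<close>.\<close>
    obtain N :: nat where N: "real N > 2 * C / e" using reals_Archimedean2 by blast
    have "2 * C / e \<ge> 0" using \<open>C \<ge> 0\<close> \<open>e > 0\<close> by simp
    then have "N \<ge> 1" using N by (cases N) auto
    have small: "C / real k < e / 2" if "k \<ge> N" for k
    proof -
      have "real k > 2 * C / e" using N that by linarith
      moreover have "real k > 0" using that \<open>N \<ge> 1\<close> by simp
      ultimately show ?thesis using \<open>e > 0\<close> by (simp add: field_simps)
    qed
    have "dist (ln (gamma d m)) (ln (gamma d n)) < e" if "m \<ge> N" "n \<ge> N" for m n
      unfolding dist_real_def using diff[of m n] small[OF that(1)] small[OF that(2)] that \<open>N \<ge> 1\<close> by linarith
    then show "\<exists>M. \<forall>m\<ge>M. \<forall>n\<ge>M. dist (ln (gamma d m)) (ln (gamma d n)) < e" by blast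
  qed
  then obtain l where l: "(\<lambda>n. ln (gamma d n)) \<longlonglongrightarrow> l"
    using Cauchy_convergent_iff convergent_def by blast
  then have "(\<lambda>n. exp (ln (gamma d n))) \<longlonglongrightarrow> exp l" by (rule tendsto_exp)
  \<comment> \<open>The index 0 is left out: \<open>exp (ln t) = t\<close> requires
    \<open>t > 0\<close>, which is known for \<open>n \<ge> 1\<close>.\<close>
  moreover have "\<forall>\<^sub>F n in sequentially. exp (ln (gamma d n)) = gamma d n"
    using eventually_ge_at_top[of 1]
    by eventually_elim (use gamma_bounds(1)[of _ d] in \<open>fastforce simp: exp_ln_iff\<close>)
  ultimately have lim: "(\<lambda>n. gamma d n) \<longlonglongrightarrow> exp l"
    by (rule Lim_transform_eventually)
  then have k: "kappa d = exp l" unfolding kappa_def by (rule limI)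
  show "(\<lambda>n. gamma d n) \<longlonglongrightarrow> kappa d" "kappa d > 0" using lim k by simp_all
  \<comment> \<open>Letting \<open>m\<close> tend to infinity in \<open>diff\<close> removes the
    term \<open>C / m\<close>.\<close>
  show "\<bar>ln (gamma d n) - ln (kappa d)\<bar> \<le> real d * ln 2 / real n" if n: "n \<ge> 1"
  proof (rule tendsto_le[OF sequentially_bot])
    show "(\<lambda>m. C / real m + C / real n) \<longlonglongrightarrow> real d * ln 2 / real n"
      unfolding C_def by (rule tendsto_eq_intros lim_const_over_n refl | simp)+
    show "(\<lambda>m. \<bar>ln (gamma d m) - ln (gamma d n)\<bar>) \<longlonglongrightarrow> \<bar>ln (gamma d n) - ln (kappa d)\<bar>"
      using tendsto_rabs[OF tendsto_diff[OF l tendsto_const[of "ln (gamma d n)"]]]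
      by (simp add: k abs_minus_commute)
    show "\<forall>\<^sub>F m in sequentially. \<bar>ln (gamma d m) - ln (gamma d n)\<bar> \<le> C / real m + C / real n"
      using eventually_ge_at_top[of 1] by eventually_elim (use diff n in auto)
  qed
qed

lemma kappa_bounds: "1 \<le> kappa d" "kappa d \<le> 2"
  using gamma_bounds[of _ d]
  by (auto intro!: tendsto_lowerbound[OF kappa_limit(1)] tendsto_upperbound[OF kappa_limit(1)]
      eventually_sequentiallyI[of 1])

lemma gamma_minus_kappa_le:
  assumes "n \<ge> 1"
  shows "\<bar>gamma d n - kappa d\<bar> \<le> 2 * real d * ln 2 / real n"
proof -
  \<comment> \<open>From \<open>1 + t \<le> exp t\<close> at \<open>t = ln (x / y)\<close>; the
    factor 2 is the upper bound for \<open>y\<close>, here \<open>gamma\<close> or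
    \<open>kappa\<close>.\<close>
  have mean_value: "y - x \<le> 2 * \<bar>ln x - ln y\<bar>" if "0 < x" "0 < y" "y \<le> 2" for x y :: real
  proof -
    have "1 + ln (x / y) \<le> x / y"
      using exp_ge_add_one_self[of "ln (x / y)"] that by simp
    then have "y * (1 - x / y) \<le> y * (ln y - ln x)"
      using that by (intro mult_left_mono) (simp_all add: ln_div)
    also have "\<dots> \<le> y * \<bar>ln x - ln y\<bar>" using that by (intro mult_left_mono) auto
    also have "\<dots> \<le> 2 * \<bar>ln x - ln y\<bar>" using that by (intro mult_right_mono) auto
    finally show ?thesis using that by (simp add: algebra_simps)
  qed
  have "\<bar>gamma d n - kappa d\<bar> \<le> 2 * \<bar>ln (gamma d n) - ln (kappa d)\<bar>"
    using mean_value[of "gamma d n" "kappa d"] mean_value[of "kappa d" "gamma d n"]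
      gamma_bounds[OF assms, of d] kappa_bounds[of d] by (auto simp: abs_le_iff abs_minus_commute)
  then show ?thesis using kappa_limit(3)[OF assms, of d] by simp
qed

section \<open>Integrality of the resultant\<close>

text \<open>This is \<open>x\<close> times the identity minus the companion matrix of
  \<open>X\<^sup>n + f\<^sub>n\<^sub>-\<^sub>1 X\<^sup>n\<^sup>-\<^sup>1 + \<dots> + f\<^sub>0\<close>.\<close>

definition companion_char_mat :: "nat \<Rightarrow> (nat \<Rightarrow> 'a :: comm_ring_1) \<Rightarrow> 'a \<Rightarrow> 'a mat" where
  "companion_char_mat n f x = mat n n (\<lambda>(i, j).
     (if i = j then x else 0) - (if i = Suc j then 1 else 0) + (if Suc j = n then f i else 0))"

lemma companion_char_mat_carrier [simp]: "companion_char_mat n f x \<in> carrier_mat n n"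
  by (simp add: companion_char_mat_def)

text \<open>Row 0 can be nonzero only in columns 0 and \<open>n\<close>. Deleting column 0 leaves a
  matrix of the same shape with shifted coefficients, for the induction; deleting column
  \<open>n\<close> leaves an upper triangular matrix with diagonal entries \<open>-1\<close>, whose
  determinant cancels the cofactor sign.\<close>

lemma det_companion_char_mat:
  fixes x :: "'a :: idom"
  assumes "n > 0"
  shows "det (companion_char_mat n f x) = x ^ n + (\<Sum>i<n. f i * x ^ i)"
  using assms
proof (induction n arbitrary: f)
  case (Suc n)
  show ?case
  proof (cases "n = 0")
    case True
    then show ?thesis by (simp add: det_single companion_char_mat_def)
  next
    case False
    let ?A = "companion_char_mat (Suc n) f x"
    have A: "?A \<in> carrier_mat (Suc n) (Suc n)" by simp
    have row: "?A $$ (0, j) = (if j = 0 then x else 0) + (if j = n then f 0 else 0)" if "j \<le> n" for j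
      using that False by (simp add: companion_char_mat_def)
    have "mat_delete ?A 0 0 = companion_char_mat n (\<lambda>i. f (Suc i)) x"
      by (rule eq_matI) (auto simp: mat_delete_def companion_char_mat_def)
    then have 0: "cofactor ?A 0 0 = x ^ n + (\<Sum>i<n. f (Suc i) * x ^ i)"
      using Suc.IH[of "\<lambda>i. f (Suc i)"] False by (simp add: cofactor_def)
    have "upper_triangular (mat_delete ?A 0 n)"
      by (rule upper_triangularI) (auto simp: mat_delete_def companion_char_mat_def)
    moreover have "mat_delete ?A 0 n \<in> carrier_mat n n"
      by (auto simp: mat_delete_def companion_char_mat_def)
    ultimately have "det (mat_delete ?A 0 n) = prod_list (diag_mat (mat_delete ?A 0 n))"
      by (rule det_upper_triangular)
    also have "diag_mat (mat_delete ?A 0 n) = map (\<lambda>_. - 1) [0..<n]"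
      unfolding diag_mat_def by (auto simp: mat_delete_def companion_char_mat_def)
    also have "prod_list \<dots> = (- 1) ^ n"
      by (simp add: map_replicate_const prod_list_replicate)
    finally have n: "cofactor ?A 0 n = 1"
      by (simp add: cofactor_def flip: power_add)
    have "det ?A = (\<Sum>j<Suc n. ?A $$ (0, j) * cofactor ?A 0 j)"
      by (rule laplace_expansion_row[OF A]) simp
    also have "\<dots> = (\<Sum>j\<in>{0, n}. ?A $$ (0, j) * cofactor ?A 0 j)"
      by (rule sum.mono_neutral_right) (auto simp: row)
    also have "\<dots> = x * (x ^ n + (\<Sum>i<n. f (Suc i) * x ^ i)) + f 0"
      using False 0 n by (simp add: row)
    also have "\<dots> = x ^ Suc n + (\<Sum>i<Suc n. f i * x ^ i)"
      by (subst sum.lessThan_Suc_shift) (simp add: algebra_simps sum_distrib_left)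
    finally show ?thesis .
  qed
qed simp

section \<open>Values of polynomials at a matrix and their determinants\<close>

lemma pow_mat_Suc_left:
  assumes "A \<in> carrier_mat n n"
  shows "A ^\<^sub>m Suc k = A * A ^\<^sub>m k"
proof (induction k)
  case (Suc k)
  have "A ^\<^sub>m Suc (Suc k) = (A * A ^\<^sub>m k) * A" using Suc by simp
  also have "\<dots> = A * (A ^\<^sub>m k * A)" by (rule assoc_mult_mat) (use assms in auto)
  finally show ?case by simp
qed (use assms in simp)

text \<open>The usual matrix \<open>p(A)\<close>, summed entry by entry so that no sum of matrices
  of a fixed size has to be formed.\<close>

definition eval_mat :: "nat \<Rightarrow> 'a :: comm_ring_1 poly \<Rightarrow> 'a mat \<Rightarrow> 'a mat" where
  "eval_mat n p A = mat n n (\<lambda>(i, j). \<Sum>k\<le>degree p. coeff p k * (A ^\<^sub>m k) $$ (i, j))"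

lemma eval_mat_carrier [simp]: "eval_mat n p A \<in> carrier_mat n n"
  by (simp add: eval_mat_def)

lemma eval_mat_upto:
  assumes "degree p \<le> N"
  shows "eval_mat n p A = mat n n (\<lambda>(i, j). \<Sum>k\<le>N. coeff p k * (A ^\<^sub>m k) $$ (i, j))"
proof -
  have "(\<Sum>k\<le>degree p. coeff p k * (A ^\<^sub>m k) $$ (i, j)) = (\<Sum>k\<le>N. coeff p k * (A ^\<^sub>m k) $$ (i, j))" for i j
    by (rule sum.mono_neutral_left) (use assms in \<open>auto simp: coeff_eq_0\<close>)
  then show ?thesis by (simp add: eval_mat_def)
qed

text \<open>The case of a linear factor of \<open>(f * p)(A) = f(A) * p(A)\<close>. It suffices for
  determinants, as polynomials split over the complex numbers.\<close>

lemma eval_mat_linear_factor: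
  fixes A :: "'a :: comm_ring_1 mat"
  assumes A: "A \<in> carrier_mat n n"
  shows "eval_mat n ([:- a, 1:] * p) A = (A - a \<cdot>\<^sub>m 1\<^sub>m n) * eval_mat n p A"
proof -
  define N where "N = degree p"
  have deg: "degree ([:- a, 1:] * p) \<le> Suc N"
    using degree_mult_le[of "[:- a, 1:]" p] by (simp add: N_def split: if_splits)
  have entry: "((A - a \<cdot>\<^sub>m 1\<^sub>m n) * eval_mat n p A) $$ (i, j)
      = (\<Sum>k\<le>N. coeff p k * (A ^\<^sub>m Suc k) $$ (i, j)) - a * (\<Sum>k\<le>N. coeff p k * (A ^\<^sub>m k) $$ (i, j))"
    if ij: "i < n" "j < n" for i j
  proof -
    have pow: "(A ^\<^sub>m Suc k) $$ (i, j) = (\<Sum>l<n. A $$ (i, l) * (A ^\<^sub>m k) $$ (l, j))" for k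
    proof -
      have "A ^\<^sub>m Suc k = A * A ^\<^sub>m k" by (rule pow_mat_Suc_left[OF A])
      then show ?thesis using A ij by (simp add: scalar_prod_def atLeast0LessThan)
    qed
    have "((A - a \<cdot>\<^sub>m 1\<^sub>m n) * eval_mat n p A) $$ (i, j)
        = (\<Sum>l<n. (A $$ (i, l) - a * (if i = l then 1 else 0)) * (\<Sum>k\<le>N. coeff p k * (A ^\<^sub>m k) $$ (l, j)))"
      using A ij by (simp add: scalar_prod_def atLeast0LessThan eval_mat_def N_def)
    also have "\<dots> = (\<Sum>l<n. A $$ (i, l) * (\<Sum>k\<le>N. coeff p k * (A ^\<^sub>m k) $$ (l, j)))
        - (\<Sum>l<n. if i = l then a * (\<Sum>k\<le>N. coeff p k * (A ^\<^sub>m k) $$ (l, j)) else 0)"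
      by (subst sum_subtractf[symmetric], rule sum.cong) (auto simp: algebra_simps)
    also have "(\<Sum>l<n. if i = l then a * (\<Sum>k\<le>N. coeff p k * (A ^\<^sub>m k) $$ (l, j)) else 0)
        = a * (\<Sum>k\<le>N. coeff p k * (A ^\<^sub>m k) $$ (i, j))"
      using ij by simp
    also have "(\<Sum>l<n. A $$ (i, l) * (\<Sum>k\<le>N. coeff p k * (A ^\<^sub>m k) $$ (l, j)))
        = (\<Sum>k\<le>N. coeff p k * (A ^\<^sub>m Suc k) $$ (i, j))"
      unfolding pow sum_distrib_left by (subst sum.swap) (simp only: mult.left_commute)
    finally show ?thesis .
  qed
  show ?thesis
  proof (rule eq_matI)
    fix i j assume "i < dim_row ((A - a \<cdot>\<^sub>m 1\<^sub>m n) * eval_mat n p A)" "j < dim_col ((A - a \<cdot>\<^sub>m 1\<^sub>m n) * eval_mat n p A)"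
    then have ij: "i < n" "j < n" using A by (auto simp: eval_mat_def)
    have "eval_mat n ([:- a, 1:] * p) A $$ (i, j)
        = (\<Sum>k\<le>Suc N. coeff (pCons 0 p) k * (A ^\<^sub>m k) $$ (i, j)) - a * (\<Sum>k\<le>Suc N. coeff p k * (A ^\<^sub>m k) $$ (i, j))"
      unfolding eval_mat_upto[OF deg] using ij
      by (simp del: sum.atMost_Suc pow_mat.simps add: sum_distrib_left sum_subtractf[symmetric] algebra_simps)
    also have "(\<Sum>k\<le>Suc N. coeff (pCons 0 p) k * (A ^\<^sub>m k) $$ (i, j)) = (\<Sum>k\<le>N. coeff p k * (A ^\<^sub>m Suc k) $$ (i, j))"
      by (subst sum.atMost_Suc_shift) (simp del: pow_mat.simps)
    also have "(\<Sum>k\<le>Suc N. coeff p k * (A ^\<^sub>m k) $$ (i, j)) = (\<Sum>k\<le>N. coeff p k * (A ^\<^sub>m k) $$ (i, j))"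
      by (simp add: coeff_eq_0 N_def del: pow_mat.simps)
    finally show "eval_mat n ([:- a, 1:] * p) A $$ (i, j) = ((A - a \<cdot>\<^sub>m 1\<^sub>m n) * eval_mat n p A) $$ (i, j)"
      using entry[OF ij] by simp
  qed (use A in \<open>auto simp: eval_mat_def\<close>)
qed

text \<open>One linear factor is split off at a time and \<open>det\<close> is multiplicative; the
  remaining constant gives \<open>c\<close> times the identity.\<close>

lemma det_eval_mat_linear_factors:
  fixes A :: "'a :: idom mat"
  assumes A: "A \<in> carrier_mat n n"
  shows "det (eval_mat n (smult c (\<Prod>a\<leftarrow>as. [:- a, 1:])) A) = c ^ n * (\<Prod>a\<leftarrow>as. det (A - a \<cdot>\<^sub>m 1\<^sub>m n))"
proof (induction as)
  case Nil
  have "eval_mat n [:c:] A = c \<cdot>\<^sub>m 1\<^sub>m n"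
    by (rule eq_matI) (use A in \<open>auto simp: eval_mat_def\<close>)
  then show ?case by simp
next
  case (Cons a as)
  have "smult c (\<Prod>a\<leftarrow>a # as. [:- a, 1:]) = [:- a, 1:] * smult c (\<Prod>a\<leftarrow>as. [:- a, 1:])"
    by simp
  then have "eval_mat n (smult c (\<Prod>a\<leftarrow>a # as. [:- a, 1:])) A
      = (A - a \<cdot>\<^sub>m 1\<^sub>m n) * eval_mat n (smult c (\<Prod>a\<leftarrow>as. [:- a, 1:])) A"
    by (simp only: eval_mat_linear_factor[OF A])
  moreover have "A - a \<cdot>\<^sub>m 1\<^sub>m n \<in> carrier_mat n n" by (intro minus_carrier_mat) simp
  ultimately show ?case
    using Cons.IH by (simp add: det_mult[where n = n] algebra_simps)
qed

text \<open>This relates the complex matrix, where \<open>p\<close> splits, to an integral one, so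
  that its determinant is an integer.\<close>

lemma eval_mat_of_int:
  assumes "B \<in> carrier_mat n n"
  shows "eval_mat n (of_int_poly p) (map_mat of_int B :: complex mat) = map_mat of_int (eval_mat n p B)"
proof -
  have "(map_mat of_int B :: complex mat) ^\<^sub>m k = map_mat of_int (B ^\<^sub>m k)" for k
    by (rule of_int_hom.mat_hom_pow[OF assms, symmetric])
  then show ?thesis
    using assms by (intro eq_matI) (auto simp: eval_mat_def)
qed

text \<open>Up to sign this is the resultant of \<open>p\<close> and \<open>q\<close>: it equals \<open>det p(C)\<close> for the integral
  companion matrix \<open>C\<close> of the monic polynomial \<open>q\<close>.\<close>

lemma resultant_integral:
  fixes p q :: "int poly"
  assumes "lead_coeff q = 1" "degree q > 0"
  shows "\<exists>z::int. \<bar>real_of_int z\<bar> = cmod (of_int (lead_coeff p) ^ degree q * (\<Prod>a\<leftarrow>complex_roots_int p. poly (of_int_poly q) a))"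
proof -
  define n where "n = degree q"
  define f where "f = (\<lambda>i. of_int (coeff q i) :: complex)"
  \<comment> \<open>At argument 0 the matrix is minus the companion matrix of \<open>q\<close>, so
    \<open>- B\<close> is the companion matrix and \<open>A\<close> is its image over the complex
    numbers.\<close>
  define B where "B = companion_char_mat n (\<lambda>i. coeff q i) 0"
  define A where "A = (map_mat of_int (- B) :: complex mat)"
  have B: "B \<in> carrier_mat n n" by (simp add: B_def)
  then have A: "A \<in> carrier_mat n n" by (simp add: A_def)
  have det_shift: "det (A - a \<cdot>\<^sub>m 1\<^sub>m n) = (- 1) ^ n * poly (of_int_poly q) a" for a
  proof -
    have "A - a \<cdot>\<^sub>m 1\<^sub>m n = (- 1) \<cdot>\<^sub>m companion_char_mat n f a"
      by (rule eq_matI) (auto simp: A_def B_def companion_char_mat_def f_def)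
    moreover have "poly (of_int_poly q) a = a ^ n + (\<Sum>i<n. f i * a ^ i)"
      using assms by (simp add: poly_altdef n_def f_def lessThan_Suc_atMost[symmetric])
    ultimately show ?thesis
      using det_companion_char_mat[of n f a] assms(2) by (simp add: n_def companion_char_mat_def)
  qed
  have "of_int (det (eval_mat n p (- B))) = det (eval_mat n (of_int_poly p) A)"
    unfolding A_def using B by (simp add: eval_mat_of_int of_int_hom.hom_det)
  also have "of_int_poly p = smult (of_int (lead_coeff p)) (\<Prod>a\<leftarrow>complex_roots_int p. [:- a, 1 :: complex:])"
    by (rule complex_roots_int(1)[symmetric])
  also have "det (eval_mat n \<dots> A) = of_int (lead_coeff p) ^ n * (\<Prod>a\<leftarrow>complex_roots_int p. (- 1) ^ n * poly (of_int_poly q) a)"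
    unfolding det_eval_mat_linear_factors[OF A] det_shift ..
  finally have eq: "of_int (det (eval_mat n p (- B)))
    = of_int (lead_coeff p) ^ n * (\<Prod>a\<leftarrow>complex_roots_int p. (- 1) ^ n * poly (of_int_poly q) a :: complex)" .
  \<comment> \<open>The signs drop out under the absolute value.\<close>
  have "cmod (\<Prod>a\<leftarrow>as. (- 1) ^ n * poly (of_int_poly q) a) = cmod (\<Prod>a\<leftarrow>as. poly (of_int_poly q) a)" for as
    by (induction as) (simp_all add: norm_mult norm_power)
  then have "\<bar>real_of_int (det (eval_mat n p (- B)))\<bar>
      = cmod (of_int (lead_coeff p) ^ n * (\<Prod>a\<leftarrow>complex_roots_int p. poly (of_int_poly q) a))"
    using arg_cong[OF eq, of cmod] by (simp add: norm_mult)
  then show ?thesis unfolding n_def by blast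
qed

section \<open>Minimal polynomials and degrees\<close>

text \<open>The defining condition of \<open>int_min_poly\<close>, stated over any field of
  characteristic 0 so that complex conjugates can be treated like the real number itself.\<close>

definition is_min_poly :: "int poly \<Rightarrow> 'a :: field_char_0 \<Rightarrow> bool" where
  "is_min_poly p x \<longleftrightarrow> content p = 1 \<and> lead_coeff p > 0 \<and> poly (of_int_poly p) x = 0 \<and>
     (\<forall>q. q \<noteq> 0 \<longrightarrow> poly (of_int_poly q) x = 0 \<longrightarrow> degree p \<le> degree q)"

lemma is_min_poly_nonzero: "is_min_poly p x \<Longrightarrow> p \<noteq> 0"
  by (auto simp: is_min_poly_def)

text \<open>The pseudo-remainder of \<open>q\<close> by \<open>p\<close> vanishes at
  \<open>x\<close> and has smaller degree, so it is 0. As \<open>p\<close> has content 1, Gauss's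
  lemma turns divisibility over the rationals into divisibility over the integers.\<close>

lemma is_min_poly_dvd:
  fixes x :: "'a :: field_char_0"
  assumes "is_min_poly p x" "poly (of_int_poly q) x = 0"
  shows "p dvd q"
proof -
  define r where "r = pseudo_mod q p"
  have p: "p \<noteq> 0" using assms(1) by (rule is_min_poly_nonzero)
  obtain a s where a: "a \<noteq> 0" and eq: "smult a q = p * s + r"
    using pseudo_mod(1)[OF p, of q] unfolding r_def by blast
  have "poly (of_int_poly (smult a q)) x = poly (of_int_poly (p * s + r)) x" by (simp only: eq)
  then have "poly (of_int_poly r) x = 0"
    using assms by (simp add: is_min_poly_def hom_distribs)
  moreover have "r = 0 \<or> degree r < degree p" unfolding r_def by (rule pseudo_mod(2)[OF p])
  ultimately have "r = 0" using assms(1) unfolding is_min_poly_def by force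
  then have "p dvd smult a q" using eq by simp
  then have "fract_poly p dvd fract_poly (smult a q)" by (rule fract_poly_dvd)
  then have "fract_poly p dvd smult (to_fract a) (fract_poly q)" by (simp only: fract_poly_smult)
  moreover have "to_fract a \<noteq> 0" using a by simp
  ultimately have "fract_poly p dvd fract_poly q" by (rule dvd_smult_cancel)
  moreover have "content p = 1" using assms(1) unfolding is_min_poly_def by blast
  ultimately show ?thesis by (rule fract_poly_dvdD)
qed

text \<open>A nonzero polynomial of least degree among those vanishing at \<open>x\<close> is made
  primitive and given a positive leading coefficient.\<close>

lemma is_min_poly_exists:
  fixes x :: "'a :: field_char_0"
  assumes "p \<noteq> 0" "poly (of_int_poly p) x = 0"
  shows "\<exists>r. is_min_poly r x"
proof -
  obtain q :: "int poly" where q: "q \<noteq> 0 \<and> poly (of_int_poly q) x = 0"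
    and least: "\<And>q'. q' \<noteq> 0 \<and> poly (of_int_poly q') x = 0 \<Longrightarrow> degree q \<le> degree q'"
    using ex_has_least_nat[of "\<lambda>q. q \<noteq> 0 \<and> poly (of_int_poly q) x = 0" p degree] assms by blast
  define u where "u = primitive_part q"
  define r where "r = smult (sgn (lead_coeff u)) u"
  have u: "u \<noteq> 0" "content u = 1" "degree u = degree q" using q by (simp_all add: u_def)
  have "smult (content q) u = q" by (simp add: u_def)
  then have "poly (of_int_poly (smult (content q) u)) x = 0" using q by simp
  then have "of_int (content q) * poly (of_int_poly u) x = 0" by (simp only: hom_distribs poly_smult)
  then have "poly (of_int_poly u) x = 0" using q by simp
  moreover have "lead_coeff u \<noteq> 0" using u(1) leading_coeff_0_iff by blast
  moreover from this have "\<bar>sgn (lead_coeff u)\<bar> = 1" by (simp add: abs_sgn_eq)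
  moreover have "degree r = degree q" using \<open>lead_coeff u \<noteq> 0\<close> u by (simp add: r_def sgn_if)
  moreover have "lead_coeff r = \<bar>lead_coeff u\<bar>"
    by (simp add: r_def lead_coeff_smult abs_sgn mult.commute)
  ultimately have "is_min_poly r x"
    using u least unfolding is_min_poly_def by (simp add: r_def hom_distribs)
  then show ?thesis by blast
qed

text \<open>The two polynomials divide each other; their positive leading coefficients exclude a
  change of sign.\<close>

lemma is_min_poly_unique:
  fixes x :: "'a :: field_char_0"
  assumes "is_min_poly p x" "is_min_poly q x"
  shows "p = q"
proof -
  have "p dvd q" "q dvd p"
    using assms is_min_poly_dvd by (auto simp: is_min_poly_def)
  have "lead_coeff f dvd lead_coeff g" if "f dvd g" for f g :: "int poly"
    using that by (elim dvdE) (simp only: lead_coeff_mult dvd_triv_left)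
  then have "lead_coeff p dvd lead_coeff q" "lead_coeff q dvd lead_coeff p"
    using \<open>p dvd q\<close> \<open>q dvd p\<close> by simp_all
  moreover have "lead_coeff p > 0" "lead_coeff q > 0"
    using assms unfolding is_min_poly_def by blast+
  ultimately have "lead_coeff p = lead_coeff q"
    by (intro zdvd_antisym_nonneg less_imp_le)
  then show ?thesis using \<open>p dvd q\<close> \<open>q dvd p\<close> by (rule poly_dvd_antisym)
qed

lemma int_min_poly:
  fixes x :: real
  assumes "algebraic x"
  shows "is_min_poly (int_min_poly x) x"
proof -
  obtain p where "p \<noteq> 0" "poly (of_int_poly p) x = 0" using assms by (rule algebraicE')
  then obtain r where "is_min_poly r x" using is_min_poly_exists by blast
  then have "\<exists>!p. is_min_poly p x"
    by (rule ex1I) (rule is_min_poly_unique[OF _ \<open>is_min_poly r x\<close>])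
  then show ?thesis
    unfolding int_min_poly_def is_min_poly_def[symmetric] by (rule theI')
qed

lemma is_min_poly_degree_pos:
  fixes x :: "'a :: field_char_0"
  assumes "is_min_poly p x"
  shows "degree p > 0"
proof (rule ccontr)
  assume "\<not> degree p > 0"
  then obtain c where "p = [:c:]" by (metis degree_eq_zeroE gr0I)
  then show False using assms by (auto simp: is_min_poly_def)
qed

text \<open>Irreducibility of the minimal polynomial, phrased for evaluation at conjugates.\<close>

lemma is_min_poly_conjugate:
  fixes x :: "'a :: field_char_0" and z :: "'b :: field_char_0"
  assumes min: "is_min_poly p x" and z: "poly (of_int_poly p) z = 0" "poly (of_int_poly q) z = 0"
  shows "poly (of_int_poly q) x = 0"
proof -
  have p: "p \<noteq> 0" using min by (rule is_min_poly_nonzero)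
  \<comment> \<open>The minimal polynomial \<open>r\<close> of \<open>z\<close> divides
    \<open>p\<close> and \<open>q\<close>. It vanishes at \<open>x\<close>, since otherwise the
    cofactor \<open>s\<close> would vanish there, and \<open>s\<close> has smaller degree than
    \<open>p\<close>.\<close>
  then obtain r where r: "is_min_poly r z" using is_min_poly_exists z(1) by blast
  obtain s where s: "p = r * s" using is_min_poly_dvd[OF r z(1)] by (elim dvdE)
  have "poly (of_int_poly r) x = 0"
  proof (rule ccontr)
    assume "poly (of_int_poly r) x \<noteq> 0"
    then have "poly (of_int_poly s) x = 0"
      using min by (simp add: is_min_poly_def s hom_distribs)
    moreover have "s \<noteq> 0" "r \<noteq> 0" using p s by auto
    ultimately have "degree p \<le> degree s" using min by (auto simp: is_min_poly_def)
    then show False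
      using s \<open>s \<noteq> 0\<close> \<open>r \<noteq> 0\<close> is_min_poly_degree_pos[OF r] by (simp add: degree_mult_eq)
  qed
  moreover obtain t where "q = r * t" using is_min_poly_dvd[OF r z(2)] by (elim dvdE)
  ultimately show ?thesis by (simp add: hom_distribs)
qed

section \<open>The field degree and its agreement with the degree of the minimal polynomial\<close>

lemma real_field_simps [simp]:
  "carrier real_field = UNIV" "x \<otimes>\<^bsub>real_field\<^esub> y = x * y" "x \<oplus>\<^bsub>real_field\<^esub> y = x + y"
  "\<one>\<^bsub>real_field\<^esub> = 1" "\<zero>\<^bsub>real_field\<^esub> = 0"
  by (simp_all add: real_field_def)

lemma field_real_field: "field real_field"
proof (rule cring.cring_fieldI)
  show "cring real_field"
  proof (rule cringI)
    show "abelian_group real_field"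
      by (rule abelian_groupI) (auto intro: exI[of _ "- x" for x])
    show "comm_monoid real_field"
      by (rule comm_monoidI) auto
  qed (simp add: algebra_simps)
  have "\<exists>y. y * x = 1 \<and> x * y = 1" if "x \<noteq> 0" for x :: real
    by (rule exI[of _ "inverse x"]) (use that in simp)
  then show "Units real_field = carrier real_field - {\<zero>\<^bsub>real_field\<^esub>}"
    by (auto simp: Units_def)
qed

lemma ring_real_field: "ring real_field"
  using field_real_field by (simp add: field_def domain_def cring_def)

lemma real_field_minus [simp]: "\<ominus>\<^bsub>real_field\<^esub> x = - x"
  by (rule abelian_group.minus_equality[OF ring.is_abelian_group[OF ring_real_field]]) simp_all

lemma real_field_inv [simp]: "x \<noteq> 0 \<Longrightarrow> inv\<^bsub>real_field\<^esub> x = inverse x"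
  by (rule monoid.inv_char[OF ring.is_monoid[OF ring_real_field]]) simp_all

lemma real_field_power [simp]: "x [^]\<^bsub>real_field\<^esub> (n :: nat) = x ^ n"
  by (induction n) (simp_all add: nat_pow_def)

lemma subfield_Rats: "subfield \<rat> real_field"
  by (rule field.subfieldI'[OF field_real_field], rule ring.subringI[OF ring_real_field]) auto

text \<open>Polynomials of \<open>HOL-Algebra\<close> are lists with the leading coefficient first,
  while \<open>Poly\<close> expects the constant term first.\<close>

lemma real_field_eval: "ring.eval real_field l x = poly (Poly (rev l)) x"
  by (induction l) (simp_all add: ring.eval.simps[OF ring_real_field] Poly_append poly_monom)

lemma Rats_common_denominator:
  assumes "finite A" "A \<subseteq> (\<rat> :: real set)"
  shows "\<exists>d::int. d \<noteq> 0 \<and> (\<forall>a\<in>A. of_int d * a \<in> \<int>)"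
  using assms
proof (induction A rule: finite_induct)
  case (insert a A)
  then obtain d :: int where d: "d \<noteq> 0" "\<forall>a\<in>A. of_int d * a \<in> \<int>" by auto
  obtain b c :: int where bc: "a = of_int b / of_int c" "c \<noteq> 0"
    using insert.prems by (auto elim!: Rats_cases')
  have "of_int (c * d) * a' \<in> \<int>" if "a' \<in> insert a A" for a'
  proof (cases "a' = a")
    case True
    then have "of_int (c * d) * a' = of_int (d * b)" using bc by simp
    then show ?thesis by (simp only: Ints_of_int)
  next
    case False
    then have "of_int d * a' \<in> \<int>" using that d by blast
    then have "of_int c * (of_int d * a') \<in> \<int>" by (rule Ints_mult[OF Ints_of_int])
    then show ?thesis by (simp only: of_int_mult mult.assoc)
  qed
  then show ?case using d bc by (intro exI[of _ "c * d"]) auto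
qed (auto intro: exI[of _ 1])

lemma clear_denominators:
  assumes "set l \<subseteq> (\<rat> :: real set)"
  shows "\<exists>d q. d \<noteq> 0 \<and> of_int_poly q = smult (of_int d) (Poly l)"
proof -
  obtain d :: int where d: "d \<noteq> 0" "\<forall>a\<in>set l. of_int d * a \<in> \<int>"
    using Rats_common_denominator[OF _ assms] by auto
  \<comment> \<open>The scaled coefficients are integers, so the floor does not change them.\<close>
  have "of_int_poly (Poly (map (\<lambda>a. \<lfloor>of_int d * a\<rfloor>) l)) = smult (of_int d) (Poly l)"
  proof (rule poly_eqI)
    fix i
    show "coeff (of_int_poly (Poly (map (\<lambda>a. \<lfloor>of_int d * a\<rfloor>) l))) i = coeff (smult (of_int d) (Poly l)) i"
      using d(2) by (cases "i < length l") (auto simp: coeff_map_poly nth_default_def)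
  qed
  then show ?thesis using d(1) by blast
qed

lemma polynomial_list_iff:
  "l \<in> carrier (\<rat>[X]\<^bsub>real_field\<^esub>) \<longleftrightarrow> l = [] \<or> set l \<subseteq> \<rat> \<and> hd l \<noteq> 0"
  by (simp add: univ_poly_carrier[symmetric] polynomial_def)

text \<open>The rationals are the prime field: sums of 1, negatives and quotients stay in the
  generated field.\<close>

lemma Rats_subset_generate_field: "\<rat> \<subseteq> generate_field real_field {x}"
proof
  let ?F = "generate_field real_field {x}"
  have nat: "of_nat n \<in> ?F" for n
  proof (induction n)
    case 0
    then show ?case using field.zero_in_generate[OF field_real_field, of "{x}"] by simp
  next
    case (Suc n)
    then show ?case using generate_field.eng_add[OF generate_field.one Suc] by simp
  qed
  have int: "of_int n \<in> ?F" for n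
  proof (cases n rule: int_cases2)
    case (nonpos m)
    then show ?thesis using generate_field.a_inv[OF nat[of m]] by simp
  qed (simp add: nat)
  fix y :: real assume "y \<in> \<rat>"
  then obtain a b :: int where "y = of_int a / of_int b" "b \<noteq> 0" by (auto elim!: Rats_cases')
  then show "y \<in> ?F"
    using generate_field.eng_mult[OF int[of a] generate_field.m_inv[OF int[of b]]] by (simp add: divide_inverse)
qed

text \<open>If the ring generated by \<open>x\<close> over the rationals is already a field, it and
  the generated field contain each other. This gives access to the dimension of a simple
  extension.\<close>

lemma generate_field_eq_simple_extension:
  assumes "subfield (ring.simple_extension real_field \<rat> x) real_field"
  shows "generate_field real_field {x} = ring.simple_extension real_field \<rat> x"
proof
  interpret R: field real_field by (rule field_real_field)
  note subfield_Rats = subfieldE(1)[OF subfield_Rats]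
  show "generate_field real_field {x} \<subseteq> R.simple_extension \<rat> x"
    using R.simple_extension_mem[OF subfield_Rats, of x] by (intro R.generate_field_min_subfield1[OF _ assms]) simp_all
  show "R.simple_extension \<rat> x \<subseteq> generate_field real_field {x}"
    by (rule R.simple_extension_subring_incl[OF subfieldE(1)[OF R.generate_field_is_subfield] Rats_subset_generate_field])
      (simp_all add: generate_field.incl)
qed

text \<open>The dimension is the degree of the monic minimal polynomial \<open>L\<close> over the
  rationals, so it remains to compare \<open>L\<close> with the integral \<open>p\<close>: each
  vanishes at \<open>x\<close> and has least degree over its own coefficients. For lists the degree
  is \<open>length - 1\<close>.\<close>

lemma alg_degree_eq:
  assumes "algebraic x"
  shows "alg_degree x = degree (int_min_poly x)"
proof -
  interpret R: field real_field by (rule field_real_field)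
  define p where "p = int_min_poly x"
  have x: "is_min_poly p x" unfolding p_def by (rule int_min_poly[OF assms])
  then have p: "p \<noteq> 0" "poly (of_int_poly p) x = 0" by (auto simp: is_min_poly_def)
  define l where "l = rev (coeffs (of_int_poly p :: real poly))"
  have "length (coeffs (of_int_poly p :: real poly)) = Suc (degree p)"
    using p by (subst length_coeffs_degree) simp_all
  moreover have "set l \<subseteq> \<rat>" by (auto simp: l_def)
  moreover have "hd l \<noteq> 0"
    using p unfolding l_def hd_rev by (subst last_coeffs_eq_coeff_degree) simp_all
  moreover have "Poly (rev l) = of_int_poly p" by (simp only: l_def rev_rev_ident Poly_coeffs)
  ultimately have l: "l \<noteq> []" "l \<in> carrier (\<rat>[X]\<^bsub>real_field\<^esub>)" "length l - 1 = degree p" "R.eval l x = 0"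
    using p by (auto simp: l_def polynomial_list_iff real_field_eval)
  have x_carrier: "x \<in> carrier real_field" by simp
  have alg: "(R.algebraic over \<rat>) x"
    using R.algebraicI[OF l(2,1)] l(4) by simp
  note Irr = R.IrrE[OF subfield_Rats x_carrier alg]
  define L where "L = R.Irr \<rat> x"
  have "L \<noteq> []" using Irr(2) by (auto simp: L_def ring_irreducible_def univ_poly_zero)
  then have L: "L \<noteq> []" "set L \<subseteq> \<rat>" "hd L = 1" "R.eval L x = 0"
    using Irr by (auto simp: L_def polynomial_list_iff)
  have "length L - 1 \<le> degree p"
    using R.pdivides_imp_degree_le[OF subfieldE(1)[OF subfield_Rats], of L l] l
      R.Irr_minimal[OF subfield_Rats x_carrier alg, of l] Irr by (simp add: L_def)
  moreover have "degree p \<le> length L - 1"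
  proof -
    \<comment> \<open>Clearing denominators in \<open>L\<close> gives a nonzero integral polynomial
      that vanishes at \<open>x\<close> and has the same degree.\<close>
    obtain d q where d: "d \<noteq> 0" and q: "of_int_poly q = smult (of_int d) (Poly (rev L))"
      using clear_denominators[of "rev L"] L by auto
    have "coeff (Poly (rev L)) (length L - 1) = 1"
      using L by (simp add: nth_default_def rev_nth hd_conv_nth)
    then have "Poly (rev L) \<noteq> 0" by (metis coeff_0 zero_neq_one)
    then have "(of_int_poly q :: real poly) \<noteq> 0" using d q by simp
    then have "q \<noteq> 0" by auto
    moreover have "poly (of_int_poly q) x = 0" using L unfolding q by (simp add: real_field_eval)
    ultimately have "degree p \<le> degree q" using x by (simp add: is_min_poly_def)
    also have "degree q = degree (of_int_poly q :: real poly)" by simp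
    also have "\<dots> = degree (Poly (rev L))" using d unfolding q by simp
    also have "\<dots> \<le> length L - 1"
      using L by (intro degree_le) (auto simp: nth_default_def)
    finally show ?thesis .
  qed
  ultimately have deg: "length L - 1 = degree p" by simp
  have "subfield (R.simple_extension \<rat> x) real_field"
    using R.simple_extension_is_subfield[OF subfield_Rats x_carrier] alg by blast
  then have "alg_degree x = (R.dim over \<rat>) (R.simple_extension \<rat> x)"
    by (simp only: alg_degree_def over_def generate_field_eq_simple_extension)
  also have "\<dots> = length L - 1"
    unfolding L_def by (rule R.simple_extension_dim[OF subfield_Rats x_carrier alg])
  finally show ?thesis using deg by (simp only: p_def)
qed

section \<open>Liouville inequalities\<close>

lemma set_complex_roots_int:
  assumes "p \<noteq> 0"
  shows "set (complex_roots_int p) = {z. poly (of_int_poly p) z = 0}"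
proof -
  have "poly (of_int_poly p) z = of_int (lead_coeff p) * (\<Prod>a\<leftarrow>complex_roots_int p. z - a)" for z
    by (subst complex_roots_int(1)[symmetric]) (simp add: poly_prod_list o_def)
  then show ?thesis using assms by (auto simp: prod_list_zero_iff)
qed

text \<open>The resultant is an integer, and it is nonzero because \<open>p\<close> and
  \<open>q\<close> share no root.\<close>

lemma resultant_ge_1:
  fixes p q :: "int poly"
  assumes "p \<noteq> 0" "lead_coeff q = 1" "degree q > 0"
    and "\<And>z :: complex. poly (of_int_poly p) z = 0 \<Longrightarrow> poly (of_int_poly q) z \<noteq> 0"
  shows "1 \<le> \<bar>real_of_int (lead_coeff p)\<bar> ^ degree q * (\<Prod>a\<leftarrow>complex_roots_int p. cmod (poly (of_int_poly q) a))"
proof -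
  let ?R = "of_int (lead_coeff p) ^ degree q * (\<Prod>a\<leftarrow>complex_roots_int p. poly (of_int_poly q) a) :: complex"
  obtain z :: int where z: "\<bar>real_of_int z\<bar> = cmod ?R"
    using resultant_integral[OF assms(2,3)] by blast
  have "(\<Prod>a\<leftarrow>complex_roots_int p. poly (of_int_poly q) a) \<noteq> 0"
    using assms(4) set_complex_roots_int[OF assms(1)] by (auto simp: prod_list_zero_iff)
  then have "?R \<noteq> 0" using assms(1) by simp
  then have "z \<noteq> 0" using z by (metis norm_eq_zero of_int_0 abs_zero)
  then have "1 \<le> \<bar>real_of_int z\<bar>" by linarith
  moreover have "cmod (\<Prod>a\<leftarrow>as. f a) = (\<Prod>a\<leftarrow>as. cmod (f a))" for as and f :: "complex \<Rightarrow> complex"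
    by (induction as) (simp_all add: norm_mult)
  ultimately show ?thesis
    unfolding z by (simp add: norm_mult norm_power)
qed

text \<open>The trivial bound \<open>B * g x\<close> is used for every factor except one occurrence
  of \<open>k\<close>, whose actual value is kept. This isolates the small factor in the Liouville
  argument.\<close>

lemma prod_list_le_single_factor:
  fixes f g :: "'a \<Rightarrow> real"
  assumes "k \<in> set xs" "B \<ge> 0"
    and "\<And>x. x \<in> set xs \<Longrightarrow> 0 \<le> f x" "\<And>x. x \<in> set xs \<Longrightarrow> 0 < g x" "\<And>x. x \<in> set xs \<Longrightarrow> f x \<le> B * g x"
  shows "(\<Prod>x\<leftarrow>xs. f x) \<le> f k / g k * B ^ (length xs - 1) * (\<Prod>x\<leftarrow>xs. g x)"
  using assms
proof (induction xs)
  case (Cons a xs)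
  note outer = Cons.prems
  \<comment> \<open>The bound without an exceptional factor: it handles the tail when
    \<open>k\<close> is the head, and otherwise supplies nonnegativity.\<close>
  have all: "0 \<le> (\<Prod>x\<leftarrow>ys. f x) \<and> 0 \<le> (\<Prod>x\<leftarrow>ys. g x) \<and> (\<Prod>x\<leftarrow>ys. f x) \<le> B ^ length ys * (\<Prod>x\<leftarrow>ys. g x)"
    if "set ys \<subseteq> set (a # xs)" for ys
    using that
  proof (induction ys)
    case (Cons y ys)
    have "y \<in> set (a # xs)" using Cons.prems by simp
    then have y: "0 \<le> f y" "0 < g y" "f y \<le> B * g y" using outer(3-5) by auto
    have IH: "0 \<le> (\<Prod>x\<leftarrow>ys. f x)" "0 \<le> (\<Prod>x\<leftarrow>ys. g x)" "(\<Prod>x\<leftarrow>ys. f x) \<le> B ^ length ys * (\<Prod>x\<leftarrow>ys. g x)"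
      using Cons by auto
    have "f y * (\<Prod>x\<leftarrow>ys. f x) \<le> (B * g y) * (B ^ length ys * (\<Prod>x\<leftarrow>ys. g x))"
      using y IH \<open>B \<ge> 0\<close> by (intro mult_mono) auto
    then show ?case using y IH by (simp add: algebra_simps)
  qed simp
  show ?case
  proof (cases "k = a")
    case True
    have "f a * (\<Prod>x\<leftarrow>xs. f x) \<le> f a * (B ^ length xs * (\<Prod>x\<leftarrow>xs. g x))"
      using all[of xs] Cons.prems(3)[of a] by (intro mult_left_mono) auto
    moreover have "g a > 0" using Cons.prems(4)[of a] by simp
    ultimately show ?thesis using True by (simp add: field_simps)
  next
    case False
    then have k: "k \<in> set xs" using Cons.prems(1) by simp
    then have IH: "(\<Prod>x\<leftarrow>xs. f x) \<le> f k / g k * B ^ (length xs - 1) * (\<Prod>x\<leftarrow>xs. g x)"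
      using Cons.prems by (intro Cons.IH) auto
    have "f a * (\<Prod>x\<leftarrow>xs. f x) \<le> (B * g a) * (f k / g k * B ^ (length xs - 1) * (\<Prod>x\<leftarrow>xs. g x))"
      using all[of xs] IH Cons.prems(2) Cons.prems(3)[of a] Cons.prems(4)[of a] Cons.prems(5)[of a]
      by (intro mult_mono) auto
    also have "\<dots> = f k / g k * (B * B ^ (length xs - 1)) * (g a * (\<Prod>x\<leftarrow>xs. g x))"
      by (simp add: algebra_simps)
    also have "B * B ^ (length xs - 1) = B ^ length xs"
      using k by (cases xs) auto
    finally show ?thesis by simp
  qed
qed simp

lemma mahler_measure_roots:
  "mahler_measure p = \<bar>real_of_int (lead_coeff p)\<bar> * (\<Prod>a\<leftarrow>complex_roots_int p. max 1 (cmod a))"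
  by (simp add: mahler_measure_def mahler_measure_poly_def complex_roots_int_def)

lemma mahler_measure_ge_1:
  assumes "p \<noteq> 0"
  shows "1 \<le> mahler_measure p"
proof -
  have "1 \<le> (\<Prod>a\<leftarrow>as. max 1 (cmod a))" for as
    by (induction as) (auto intro: order_trans[OF _ mult_mono[of 1 _ 1]])
  moreover have "1 \<le> \<bar>real_of_int (lead_coeff p)\<bar>"
    using assms leading_coeff_0_iff[of p] by linarith
  ultimately show ?thesis unfolding mahler_measure_roots using mult_mono[of 1 _ 1] by force
qed

lemma prod_list_map_power:
  "(\<Prod>a\<leftarrow>as. f a ^ n) = (\<Prod>a\<leftarrow>as. f a :: 'a :: comm_monoid_mult) ^ n"
  by (induction as) (simp_all add: power_mult_distrib)

text \<open>The Liouville inequality: every conjugate other than \<open>k\<close> contributes at most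
  \<open>B max(1, |a|)\<^sup>n\<close> to the resultant.\<close>

lemma liouville_inequality:
  fixes p q :: "int poly" and k :: complex
  assumes p: "p \<noteq> 0" and q: "lead_coeff q = 1" "degree q > 0"
    and coprime: "\<And>z :: complex. poly (of_int_poly p) z = 0 \<Longrightarrow> poly (of_int_poly q) z \<noteq> 0"
    and k: "poly (of_int_poly p) k = 0" and B: "B \<ge> 0"
    and bound: "\<And>z. cmod (poly (of_int_poly q) z) \<le> B * max 1 (cmod z) ^ degree q"
  shows "1 \<le> cmod (poly (of_int_poly q) k) / max 1 (cmod k) ^ degree q * B ^ (degree p - 1)
    * mahler_measure p ^ degree q"
proof -
  let ?as = "complex_roots_int p" and ?n = "degree q"
  have "k \<in> set ?as" using k set_complex_roots_int[OF p] by simp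
  then have "(\<Prod>a\<leftarrow>?as. cmod (poly (of_int_poly q) a))
      \<le> cmod (poly (of_int_poly q) k) / max 1 (cmod k) ^ ?n * B ^ (degree p - 1) * (\<Prod>a\<leftarrow>?as. max 1 (cmod a) ^ ?n)"
    using prod_list_le_single_factor[of k ?as B "\<lambda>a. cmod (poly (of_int_poly q) a)" "\<lambda>a. max 1 (cmod a) ^ ?n"]
      B bound by (simp add: complex_roots_int(2))
  then have "\<bar>real_of_int (lead_coeff p)\<bar> ^ ?n * (\<Prod>a\<leftarrow>?as. cmod (poly (of_int_poly q) a))
      \<le> \<bar>real_of_int (lead_coeff p)\<bar> ^ ?n * (cmod (poly (of_int_poly q) k) / max 1 (cmod k) ^ ?n * B ^ (degree p - 1)
        * (\<Prod>a\<leftarrow>?as. max 1 (cmod a) ^ ?n))"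
    by (intro mult_left_mono) auto
  also have "(\<Prod>a\<leftarrow>?as. max 1 (cmod a) ^ ?n) = (\<Prod>a\<leftarrow>?as. max 1 (cmod a)) ^ ?n"
    by (rule prod_list_map_power)
  finally have "\<bar>real_of_int (lead_coeff p)\<bar> ^ ?n * (\<Prod>a\<leftarrow>?as. cmod (poly (of_int_poly q) a))
      \<le> cmod (poly (of_int_poly q) k) / max 1 (cmod k) ^ ?n * B ^ (degree p - 1) * mahler_measure p ^ ?n"
    by (simp only: mahler_measure_roots power_mult_distrib ac_simps)
  moreover have "1 \<le> \<bar>real_of_int (lead_coeff p)\<bar> ^ ?n * (\<Prod>a\<leftarrow>?as. cmod (poly (of_int_poly q) a))"
    using p q coprime by (rule resultant_ge_1)
  ultimately show ?thesis by linarith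
qed

section \<open>Approximation by natural numbers and by their \<open>N\<close>-th roots\<close>

definition power_minus_poly :: "nat \<Rightarrow> nat \<Rightarrow> int poly" where
  "power_minus_poly N a = monom 1 N + [:- int a:]"

lemma poly_power_minus_poly:
  "poly (of_int_poly (power_minus_poly N a)) z = z ^ N - (of_nat a :: 'a :: field_char_0)"
  by (simp add: power_minus_poly_def hom_distribs poly_monom)

lemma degree_power_minus_poly:
  assumes "N > 0"
  shows "degree (power_minus_poly N a) = N" "lead_coeff (power_minus_poly N a) = 1"
proof -
  show deg: "degree (power_minus_poly N a) = N"
    unfolding power_minus_poly_def using assms by (subst degree_add_eq_left) (simp_all add: degree_monom_eq)
  show "lead_coeff (power_minus_poly N a) = 1"
    unfolding deg using assms by (simp add: power_minus_poly_def coeff_pCons split: nat.split)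
qed

lemma algebraic_if_power_eq:
  fixes x :: real
  assumes "N > 0" "x ^ N = real a"
  shows "algebraic x"
proof (rule algebraicI)
  let ?p = "of_int_poly (power_minus_poly N a) :: real poly"
  show "coeff ?p i \<in> \<int>" for i by simp
  show "?p \<noteq> 0" using degree_power_minus_poly(2)[OF assms(1), of a] by auto
  show "poly ?p x = 0" using assms(2) by (simp add: poly_power_minus_poly)
qed

lemma ln_mahler_measure:
  assumes "algebraic x"
  shows "ln (mahler_measure (int_min_poly x)) = real (alg_degree x) * weil_height x"
  using is_min_poly_degree_pos[OF int_min_poly[OF assms]]
  by (simp add: weil_height_def alg_degree_eq[OF assms])

lemma weil_height_nonneg:
  assumes "algebraic x"
  shows "weil_height x \<ge> 0"
  unfolding weil_height_def
  using mahler_measure_ge_1[OF is_min_poly_nonzero[OF int_min_poly[OF assms]]] by simp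

lemma of_int_poly_of_real:
  "poly (of_int_poly p) (of_real x :: complex) = of_real (poly (of_int_poly p) x)"
  by (induction p) (simp_all add: map_poly_pCons)

lemma is_min_poly_of_real:
  fixes x :: real
  shows "is_min_poly p x \<Longrightarrow> poly (of_int_poly p) (of_real x :: complex) = 0"
  by (simp add: is_min_poly_def of_int_poly_of_real)

text \<open>The Liouville inequality for \<open>q = X^N - a\<close>. As
  \<open>a \<le> 2 ^ N\<close>, \<open>|q(z)|\<close> is at most
  \<open>2 ^ (N + 1) * max 1 |z| ^ N\<close>, which is where \<open>N + 1\<close> comes
  from.\<close>

lemma ln_power_minus_le:
  fixes x :: real
  assumes x: "algebraic x" and N: "N > 0" and a: "a \<le> 2 ^ N" and ne: "real a \<noteq> x ^ N"
  shows "- ln \<bar>real a - x ^ N\<bar> \<le> real (alg_degree x) * (real (N + 1) * ln 2) + real N * (real (alg_degree x) * weil_height x)"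
proof -
  define p where "p = int_min_poly x"
  define q where "q = power_minus_poly N a"
  define M where "M = mahler_measure p"
  have p: "is_min_poly p x" unfolding p_def by (rule int_min_poly[OF x])
  have D: "degree p > 0" "degree p = alg_degree x"
    using is_min_poly_degree_pos[OF p] alg_degree_eq[OF x] by (simp_all add: p_def)
  have q: "degree q = N" "lead_coeff q = 1" using degree_power_minus_poly[OF N] by (simp_all add: q_def)
  have bound: "cmod (poly (of_int_poly q) z) \<le> 2 ^ (N + 1) * max 1 (cmod z) ^ degree q" for z
  proof -
    have a': "real a \<le> 2 ^ N" using of_nat_mono[OF a, where 'a = real] by simp
    have "cmod (z ^ N - of_nat a) \<le> cmod z ^ N + real a"
      by (rule order_trans[OF norm_triangle_ineq4]) (simp add: norm_power)
    also have "\<dots> \<le> max 1 (cmod z) ^ N + 2 ^ N"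
      using a' by (intro add_mono power_mono) auto
    also have "\<dots> \<le> 2 ^ N * max 1 (cmod z) ^ N + 2 ^ N * max 1 (cmod z) ^ N"
      using mult_right_mono[of 1 "2 ^ N" "max 1 (cmod z) ^ N"] mult_left_mono[of 1 "max 1 (cmod z) ^ N" "2 ^ N"]
      by (intro add_mono) (auto simp: one_le_power)
    finally show ?thesis unfolding q(1) by (simp add: q_def poly_power_minus_poly)
  qed
  \<comment> \<open>A common root would make \<open>q\<close> vanish at \<open>x\<close> itself,
    against \<open>ne\<close>.\<close>
  have "poly (of_int_poly q) z \<noteq> 0" if "poly (of_int_poly p) z = 0" for z :: complex
    using is_min_poly_conjugate[OF p that, of q] ne by (auto simp: q_def poly_power_minus_poly)
  then have "1 \<le> cmod (poly (of_int_poly q) (of_real x)) / max 1 (cmod (of_real x)) ^ degree q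
      * (2 ^ (N + 1)) ^ (degree p - 1) * mahler_measure p ^ degree q"
    using p q N bound by (intro liouville_inequality is_min_poly_nonzero is_min_poly_of_real) auto
  also have "cmod (poly (of_int_poly q) (of_real x)) = \<bar>real a - x ^ N\<bar>"
  proof -
    have "poly (of_int_poly q) (of_real x :: complex) = of_real (x ^ N - real a)"
      by (simp add: q_def poly_power_minus_poly)
    then show ?thesis by (simp only: norm_of_real abs_minus_commute)
  qed
  \<comment> \<open>Dropping the denominator, which is at least 1, and raising the exponent of
    \<open>2 ^ (N + 1)\<close> by one produces the closed form with \<open>degree p\<close>.\<close>
  also have "\<bar>real a - x ^ N\<bar> / max 1 (cmod (of_real x)) ^ degree q * (2 ^ (N + 1)) ^ (degree p - 1) * mahler_measure p ^ degree q
      \<le> \<bar>real a - x ^ N\<bar> * (2 ^ (N + 1)) ^ degree p * M ^ N"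
  proof -
    have M: "M \<ge> 1" unfolding M_def using mahler_measure_ge_1 is_min_poly_nonzero[OF p] .
    have "\<bar>real a - x ^ N\<bar> / max 1 (cmod (of_real x)) ^ N \<le> \<bar>real a - x ^ N\<bar>"
      using divide_left_mono[of 1 "max 1 (cmod (of_real x)) ^ N" "\<bar>real a - x ^ N\<bar>"]
      by (simp add: one_le_power)
    moreover have "((2::real) ^ (N + 1)) ^ (degree p - 1) \<le> (2 ^ (N + 1)) ^ degree p"
      by (intro power_increasing one_le_power) simp_all
    ultimately show ?thesis
      using M unfolding q(1) M_def[symmetric] by (intro mult_mono) auto
  qed
  finally have ge: "1 \<le> \<bar>real a - x ^ N\<bar> * (2 ^ (N + 1)) ^ degree p * M ^ N" .
  have M: "M \<ge> 1" unfolding M_def using mahler_measure_ge_1 is_min_poly_nonzero[OF p] .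
  have "0 \<le> ln (\<bar>real a - x ^ N\<bar> * (2 ^ (N + 1)) ^ degree p * M ^ N)"
    using ge by simp
  also have "\<dots> = ln \<bar>real a - x ^ N\<bar> + real (degree p) * (real (N + 1) * ln 2) + real N * ln M"
    using ne M by (simp add: ln_mult ln_realpow del: power_Suc)
  finally show ?thesis
    using ln_mahler_measure[OF x] D(2) unfolding M_def p_def by simp
qed

text \<open>The Liouville inequality for the minimal polynomial \<open>q\<close> of
  \<open>y\<close>. Its roots are \<open>N\<close>-th roots of \<open>a\<close>, so they all have
  modulus \<open>y \<le> 2\<close>; this bounds \<open>q\<close> through its factorization instead
  of its coefficients.\<close>

lemma ln_root_minus_le:
  fixes x y :: real
  assumes x: "algebraic x" and N: "N > 0" and y: "y ^ N = real a" "1 \<le> y" "y \<le> 2" and ne: "real a \<noteq> x ^ N"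
  shows "- ln \<bar>y - x\<bar> \<le> real (alg_degree y) * (real (alg_degree x) * (weil_height x + 2 * ln 2))"
proof -
  define p where "p = int_min_poly x"
  define q where "q = int_min_poly y"
  define M where "M = mahler_measure p"
  define as where "as = complex_roots_int q"
  define m where "m = max 1 \<bar>x\<bar>"
  have y_alg: "algebraic y" using N y(1) by (rule algebraic_if_power_eq)
  have p: "is_min_poly p x" unfolding p_def by (rule int_min_poly[OF x])
  have q: "is_min_poly q y" unfolding q_def by (rule int_min_poly[OF y_alg])
  have D: "degree p > 0" "degree p = alg_degree x"
    using is_min_poly_degree_pos[OF p] alg_degree_eq[OF x] by (simp_all add: p_def)
  have g: "degree q > 0" "degree q = alg_degree y"
    using is_min_poly_degree_pos[OF q] alg_degree_eq[OF y_alg] by (simp_all add: q_def)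
  have M: "M \<ge> 1" unfolding M_def using mahler_measure_ge_1 is_min_poly_nonzero[OF p] .
  have "q dvd power_minus_poly N a"
    using y(1) by (intro is_min_poly_dvd[OF q]) (simp add: poly_power_minus_poly)
  then obtain t where t: "power_minus_poly N a = q * t" by (elim dvdE)
  \<comment> \<open>\<open>q\<close> divides a monic integral polynomial and has positive leading
    coefficient, so it is monic, as \<open>liouville_inequality\<close> requires.\<close>
  have "lead_coeff q * lead_coeff t = 1"
    using degree_power_minus_poly(2)[OF N, of a] unfolding t lead_coeff_mult .
  then have monic: "lead_coeff q = 1"
    using q pos_zmult_eq_1_iff[of "lead_coeff q" "lead_coeff t"] unfolding is_min_poly_def by blast
  have root: "z ^ N = of_nat a" if "poly (of_int_poly q) z = 0" for z :: "'b :: field_char_0"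
    using that poly_power_minus_poly[of N a z] unfolding t by (simp add: hom_distribs)
  have norm_root: "cmod b = y" if "b \<in> set as" for b
  proof -
    have "b ^ N = of_nat a"
      using that root set_complex_roots_int[OF is_min_poly_nonzero[OF q]] by (simp add: as_def)
    then have "cmod b ^ N = y ^ N" using y(1) by (metis norm_power norm_of_nat)
    then show ?thesis using N y(2) by (intro power_eq_imp_eq_base[of "cmod b" N y]) auto
  qed
  have q_eq: "cmod (poly (of_int_poly q) z) = (\<Prod>b\<leftarrow>as. cmod (z - b))" for z
  proof -
    have "poly (of_int_poly q) z = (\<Prod>b\<leftarrow>as. z - b)"
      unfolding as_def by (subst complex_roots_int(1)[symmetric]) (simp add: monic poly_prod_list o_def)
    moreover have "cmod (\<Prod>b\<leftarrow>bs. z - b) = (\<Prod>b\<leftarrow>bs. cmod (z - b))" for bs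
      by (induction bs) (simp_all add: norm_mult)
    ultimately show ?thesis by simp
  qed
  have len: "length as = degree q" by (simp add: as_def complex_roots_int(2))
  \<comment> \<open>The constant 4 is the source of \<open>2 * ln 2\<close> in the bound.\<close>
  have factor: "cmod (z - b) \<le> 4 * max 1 (cmod z)" if "b \<in> set as" for z b
    using norm_triangle_ineq4[of z b] norm_root[OF that] y(3) by linarith
  have y_root: "of_real y \<in> set as"
    using is_min_poly_of_real[OF q] set_complex_roots_int[OF is_min_poly_nonzero[OF q]] by (simp add: as_def)
  have bound: "cmod (poly (of_int_poly q) z) \<le> 4 ^ degree q * max 1 (cmod z) ^ degree q" for z
  proof -
    have "(\<Prod>b\<leftarrow>bs. cmod (z - b)) \<le> (4 * max 1 (cmod z)) ^ length bs" if "set bs \<subseteq> set as" for bs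
      using that by (induction bs) (auto intro!: mult_mono factor prod_list_nonneg)
    then show ?thesis unfolding q_eq len[symmetric] power_mult_distrib[symmetric] by blast
  qed
  \<comment> \<open>The factor \<open>|x - y|\<close> of \<open>|q(x)|\<close> is isolated and each
    of the remaining factors is bounded by \<open>4 * m\<close>, so \<open>q(x)\<close> is small
    when \<open>x\<close> is near \<open>y\<close>.\<close>
  have "cmod (poly (of_int_poly q) (of_real x)) \<le> \<bar>y - x\<bar> * (4 * m) ^ (degree q - 1)"
    using prod_list_le_single_factor[of "of_real y" as "4 * m" "\<lambda>b. cmod (of_real x - b)" "\<lambda>_. 1"]
      y_root factor[of _ "of_real x"] unfolding q_eq len
    by (simp add: m_def map_replicate_const flip: of_real_diff) (simp add: abs_minus_commute)
  also have "\<dots> \<le> \<bar>y - x\<bar> * (4 * m) ^ degree q"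
    by (intro mult_left_mono power_increasing) (auto simp: m_def)
  finally have at_x: "cmod (poly (of_int_poly q) (of_real x)) / m ^ degree q \<le> \<bar>y - x\<bar> * 4 ^ degree q"
    by (simp add: m_def power_mult_distrib divide_le_eq mult.assoc)
  have "poly (of_int_poly q) z \<noteq> 0" if "poly (of_int_poly p) z = 0" for z :: complex
    using is_min_poly_conjugate[OF p that, of q] root[of x] ne by auto
  then have "1 \<le> cmod (poly (of_int_poly q) (of_real x)) / max 1 (cmod (of_real x)) ^ degree q
      * (4 ^ degree q) ^ (degree p - 1) * mahler_measure p ^ degree q"
    using p monic g(1) bound by (intro liouville_inequality is_min_poly_nonzero is_min_poly_of_real) auto
  also have "\<dots> \<le> (\<bar>y - x\<bar> * 4 ^ degree q) * (4 ^ degree q) ^ (degree p - 1) * M ^ degree q"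
    using at_x M unfolding M_def[symmetric] by (intro mult_right_mono) (simp_all add: m_def)
  \<comment> \<open>The factor \<open>4 ^ degree q\<close> coming from \<open>x\<close> supplies the
    missing power, as \<open>degree p > 0\<close>.\<close>
  also have "\<dots> = \<bar>y - x\<bar> * ((4 ^ degree q) ^ degree p * M ^ degree q)"
    using D(1) by (cases "degree p") simp_all
  finally have ge: "1 \<le> \<bar>y - x\<bar> * ((4 ^ degree q) ^ degree p * M ^ degree q)" .
  have "y \<noteq> x" using y(1) ne by auto
  have ln4: "ln (4 :: real) = 2 * ln 2" using ln_realpow[of 2 2] by simp
  have "0 \<le> ln (\<bar>y - x\<bar> * ((4 ^ degree q) ^ degree p * M ^ degree q))"
    using ge by simp
  also have "\<dots> = ln \<bar>y - x\<bar> + (real (degree p) * (real (degree q) * (2 * ln 2)) + real (degree q) * ln M)"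
    using \<open>y \<noteq> x\<close> M by (simp add: ln_mult ln_realpow ln4)
  also have "ln M = real (degree p) * weil_height x"
    using ln_mahler_measure[OF x] D(2) by (simp add: M_def p_def)
  finally show ?thesis using D(2) g(2) by (simp add: algebra_simps)
qed

theorem theorem4p15:
  fixes d D :: nat and h0 C1 :: real
  assumes "d \<ge> 1"
    and "algebraic (kappa d)"
    and "D = alg_degree (kappa d)"
    and "h0 = weil_height (kappa d)"
    and "C1 = h0 + 2 * ln 2"
  shows "(\<forall>n\<ge>1. real (indep_count d n) \<noteq> kappa d ^ (n ^ d) \<longrightarrow>
            - (1 / real (n ^ d)) * ln \<bar>real (indep_count d n) - kappa d ^ (n ^ d)\<bar>
              \<le> real D * (ln 2 + h0) + real D * ln 2 / real (n ^ d)) \<and>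
         (\<forall>n\<ge>1. real (indep_count d n) \<noteq> kappa d ^ (n ^ d) \<longrightarrow>
            real (alg_degree (gamma d n)) \<ge> - ln \<bar>gamma d n - kappa d\<bar> / (real D * C1) \<and>
            - ln \<bar>gamma d n - kappa d\<bar> / (real D * C1)
              \<ge> (ln (real n) - ln (2 * sqrt 3 * real d * ln 2)) / (real D * C1))"
proof (intro conjI allI impI)
  fix n :: nat
  assume n: "n \<ge> 1" and ne: "real (indep_count d n) \<noteq> kappa d ^ (n ^ d)"
  have N: "n ^ d > 0" using n by simp
  define L where "L = ln \<bar>real (indep_count d n) - kappa d ^ (n ^ d)\<bar>"
  have "- L \<le> real D * (real (n ^ d + 1) * ln 2) + real (n ^ d) * (real D * h0)"
    using ln_power_minus_le[OF assms(2) N indep_count_trivial_bounds(2)[OF n] ne]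
    unfolding assms(3,4) L_def .
  then have "- L / real (n ^ d) \<le> (real D * (real (n ^ d + 1) * ln 2) + real (n ^ d) * (real D * h0)) / real (n ^ d)"
    by (rule divide_right_mono) simp
  also have "\<dots> = real D * (ln 2 + h0) + real D * ln 2 / real (n ^ d)"
    using n by (simp add: field_simps)
  finally show "- (1 / real (n ^ d)) * L \<le> real D * (ln 2 + h0) + real D * ln 2 / real (n ^ d)"
    by simp
next
  fix n :: nat
  assume n: "n \<ge> 1" and ne: "real (indep_count d n) \<noteq> kappa d ^ (n ^ d)"
  have N: "n ^ d > 0" using n by simp
  have "D > 0"
    using is_min_poly_degree_pos[OF int_min_poly[OF assms(2)]] alg_degree_eq[OF assms(2)] assms(3) by simp
  moreover have "C1 > 0"
    using weil_height_nonneg[OF assms(2)] ln_gt_zero[of 2] unfolding assms(4,5) by linarith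
  ultimately have DC: "real D * C1 > 0" by simp
  have "- ln \<bar>gamma d n - kappa d\<bar> \<le> real (alg_degree (gamma d n)) * (real D * C1)"
    using ln_root_minus_le[OF assms(2) N gamma_power[OF n] gamma_bounds[OF n] ne]
    unfolding assms(3-5) .
  then show "- ln \<bar>gamma d n - kappa d\<bar> / (real D * C1) \<le> real (alg_degree (gamma d n))"
    using DC by (simp only: pos_divide_le_eq)
  have "gamma d n \<noteq> kappa d" using gamma_power[OF n, of d] ne by auto
  have "\<bar>gamma d n - kappa d\<bar> \<le> 2 * real d * ln 2 / real n"
    by (rule gamma_minus_kappa_le[OF n])
  \<comment> \<open>\<open>1 \<le> sqrt 3\<close> passes to the larger constant of the
    statement.\<close>
  also have "\<dots> \<le> 2 * sqrt 3 * real d * ln 2 / real n"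
    using mult_right_mono[of 1 "sqrt 3" "real d * ln 2"] by (intro divide_right_mono) (simp_all add: mult_ac)
  finally have "ln \<bar>gamma d n - kappa d\<bar> \<le> ln (2 * sqrt 3 * real d * ln 2 / real n)"
    using \<open>gamma d n \<noteq> kappa d\<close> by (intro ln_mono) auto
  also have "\<dots> = ln (2 * sqrt 3 * real d * ln 2) - ln (real n)"
    using n assms(1) by (simp add: ln_div)
  finally show "(ln (real n) - ln (2 * sqrt 3 * real d * ln 2)) / (real D * C1) \<le> - ln \<bar>gamma d n - kappa d\<bar> / (real D * C1)"
    using DC by (intro divide_right_mono) auto
qed

end
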